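(* Let $\mu$ be a probability measure on $\mathbb{R}$ with positive distribution density $p_\mu$, let $F_\mu$ be its distribution function, and set $\hat F_\mu=\min(F_\mu,1-F_\mu)$. Then for every absolutely continuous function $f:\mathbb{R}\to\mathbb{R}$ with $\int_{\mathbb{R}}f^2\,d\mu<\infty$, $$\mathbf{Ent}_\mu\, f^2\le\int_{\mathbb{R}}K(x)\bigl(f'(x)\bigr)^2\,\mu(dx),\qquad K(x)=8\left(\frac{\hat F_\mu(x)}{p_\mu(x)}\right)^2\left(\log\frac{1}{2\hat F_\mu(x)}+1\right).$$
   Context: For a function $f$ with $\int f^2\,d\mu<\infty$, $\mathbf{Ent}_\mu f^2=\int f^2\log f^2\,d\mu-\bigl(\int f^2\,d\mu\bigr)\log\bigl(\int f^2\,d\mu\bigr)$, with $0\log 0=0$; this takes values in $[0,\infty]$. The measure $\mu$ is absolutely continuous with respect to Lebesgue measure, with density $p_\mu>0$, and $F_\mu(x)=\mu((-\infty,x])$. Absolute continuity of $f$ on $\mathbb{R}$ means absolute continuity on every compact interval, and $f'$ is the Lebesgue-a.e. defined derivative. Both sides may equal $+\infty$. *)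

theory Defs
  imports "HOL-Probability.Probability"
begin

definition absolutely_continuous_interval :: "real \<Rightarrow> real \<Rightarrow> (real \<Rightarrow> real) \<Rightarrow> bool" where
  "absolutely_continuous_interval a b f \<longleftrightarrow>
     (\<forall>\<epsilon>>0. \<exists>\<delta>>0. \<forall>(n::nat) (u::nat \<Rightarrow> real) (v::nat \<Rightarrow> real).
        (\<forall>i<n. a \<le> u i \<and> u i \<le> v i \<and> v i \<le> b) \<and>
        disjoint_family_on (\<lambda>i. {u i<..<v i}) {..<n} \<and>
        (\<Sum>i<n. v i - u i) < \<delta>
        \<longrightarrow> (\<Sum>i<n. \<bar>f (v i) - f (u i)\<bar>) < \<epsilon>)"

definition absolutely_continuous_real :: "(real \<Rightarrow> real) \<Rightarrow> bool" where
  "absolutely_continuous_real f \<longleftrightarrow> (\<forall>a b. a \<le> b \<longrightarrow> absolutely_continuous_interval a b f)"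

(* The Bochner integral would return 0 for a non-integrable function, so the integral
   is taken in the extended sense, as the integral of the positive part minus that of
   the negative part. *)
definition ext_integral :: "'a measure \<Rightarrow> ('a \<Rightarrow> real) \<Rightarrow> ereal" where
  "ext_integral M h =
     enn2ereal (\<integral>\<^sup>+ x. ennreal (h x) \<partial>M) - enn2ereal (\<integral>\<^sup>+ x. ennreal (- h x) \<partial>M)"

lemma ext_integral_eq_integral:
  assumes "integrable M h"
  shows "ext_integral M h = ereal (integral\<^sup>L M h)"
proof -
  have "(\<integral>\<^sup>+ x. ennreal (h x) \<partial>M) \<noteq> \<infinity>" "(\<integral>\<^sup>+ x. ennreal (- h x) \<partial>M) \<noteq> \<infinity>"
    using assms by (auto simp: real_integrable_def)
  then show ?thesis
    unfolding ext_integral_def real_lebesgue_integral_def[OF assms]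
    by (cases "\<integral>\<^sup>+ x. ennreal (h x) \<partial>M"; cases "\<integral>\<^sup>+ x. ennreal (- h x) \<partial>M") auto
qed

(* Meant for g \<ge> 0 integrable over a probability measure. The convention 0 log 0 = 0 holds
   automatically. Since t log t \<ge> -1 for t \<ge> 0, the negative part always has finite integral. *)
definition Ent :: "'a measure \<Rightarrow> ('a \<Rightarrow> real) \<Rightarrow> ereal" where
  "Ent M g = ext_integral M (\<lambda>x. g x * ln (g x))
             - ereal ((\<integral>x. g x \<partial>M) * ln (\<integral>x. g x \<partial>M))"

definition F_hat :: "real measure \<Rightarrow> real \<Rightarrow> real" where
  "F_hat \<mu> x = min (cdf \<mu> x) (1 - cdf \<mu> x)"

definition K_weight :: "real measure \<Rightarrow> (real \<Rightarrow> real) \<Rightarrow> real \<Rightarrow> real" where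
  "K_weight \<mu> p x = 8 * (F_hat \<mu> x / p x)\<^sup>2 * (ln (1 / (2 * F_hat \<mu> x)) + 1)"

end

theory Submission
  imports Defs
begin

text \<open>The inequality is a logarithmic Sobolev inequality, obtained by comparing two measures on the line
through a reference probability measure \<open>\<nu>\<close> with density \<open>exp (-V)\<close>. Take
\<open>V y = y\<^sup>2 + 2 * \<bar>y\<bar> - ln (1 + \<bar>y\<bar>)\<close>. Then the tails of \<open>\<nu>\<close> are
\<open>exp (1 - (1 + \<bar>y\<bar>)\<^sup>2) / 2\<close>, so that its quantile function \<open>q\<close> is explicit, and
\<open>V T \<ge> V y + V' y * (T - y) + (T - y)\<^sup>2\<close> (\<open>potential_tangent\<close>). The function
\<open>I = exp (-V) \<circ> q\<close> (\<open>profile\<close>) satisfies \<open>q' = 1 / I\<close> and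
\<open>(I u)\<^sup>2 = 4 * m\<^sup>2 * (ln (1 / (2 * m)) + 1)\<close> with \<open>m = min u (1 - u)\<close>; hence the weight of the
theorem is \<open>K = 2 * (I F / p)\<^sup>2\<close>, where \<open>F\<close> is the distribution function of \<open>\<mu>\<close>; this is twice the
weight that the argument below produces.

Let \<open>Z\<close> be the integral of \<open>f\<^sup>2\<close>, let \<open>G\<close> be the distribution function of \<open>f\<^sup>2 \<mu> / Z\<close>, and put
\<open>\<theta> = q G - q F\<close>. Up to the change of variable \<open>y = q F\<close>, the map \<open>y \<mapsto> y + \<theta>\<close> transports
\<open>f\<^sup>2 \<mu> / Z\<close> to \<open>\<nu>\<close>. The change of variables formula for this map, the bound \<open>ln x \<le> x - 1\<close> and the
convexity of \<open>V\<close> give, almost everywhere,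
\<open>p * ln (f\<^sup>2 / Z) \<le> (I F * \<theta>)' - p * \<theta>\<^sup>2\<close> (\<open>transport_log_inequality\<close>). Multiplying by \<open>f\<^sup>2\<close>,
moving the derivative to \<open>f\<^sup>2\<close> and completing the square leads to
\<open>f\<^sup>2 * p * ln (f\<^sup>2 / Z) \<le> (f\<^sup>2 * I F * \<theta>)' + (I F)\<^sup>2 / p * f'\<^sup>2\<close> (\<open>completing_square\<close>).
Integrated over an interval this is \<open>log_sobolev_on_interval\<close>. If \<open>f\<close> lies between two positive
constants, then \<open>G\<close> is comparable to \<open>F\<close> near both ends, \<open>\<theta>\<close> is bounded, and the boundary terms
vanish because \<open>I\<close> vanishes at 0 and 1 (\<open>log_sobolev_bounded\<close>). The general case follows by
truncating \<open>\<bar>f\<bar>\<close> from below and above, which does not increase \<open>\<bar>f'\<bar>\<close>, and Fatou's lemma for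
\<open>t ln t\<close>.

The integration step needs the fundamental theorem of calculus for absolutely continuous functions
(\<open>abs_cont_FTC\<close>), including the almost everywhere existence of the derivative. An absolutely
continuous function is a difference of two monotone ones, obtained from its variation over dyadic
partitions; a monotone one defines a Stieltjes measure that vanishes on Lebesgue null sets, hence
has a density by the Radon-Nikodym theorem; and Lebesgue's differentiation theorem identifies this
density with the derivative.\<close>

section \<open>Absolute continuity on the whole line\<close>

text \<open>Absolute continuity with one \<open>\<delta>\<close> for all intervals of the line. A function on a compact interval
is brought into this form by clamping its argument, so that later arguments need not keep track of
endpoints. The families are indexed by integers because the dyadic cells of a fixed level are.\<close>

definition abs_cont :: "(real \<Rightarrow> real) \<Rightarrow> bool" where
  "abs_cont f \<longleftrightarrow>
     (\<forall>\<epsilon>>0. \<exists>\<delta>>0. \<forall>(I::int set) u v.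
        finite I \<and> (\<forall>i\<in>I. u i \<le> v i) \<and> disjoint_family_on (\<lambda>i. {u i<..<v i}) I \<and>
        (\<Sum>i\<in>I. v i - u i) < \<delta> \<longrightarrow> (\<Sum>i\<in>I. \<bar>f (v i) - f (u i)\<bar>) < \<epsilon>)"

definition clamp_to :: "real \<Rightarrow> real \<Rightarrow> real \<Rightarrow> real" where
  "clamp_to a b x = max a (min b x)"

lemma clamp_to_props:
  assumes "a \<le> b"
  shows "clamp_to a b x \<in> {a..b}"
    and "x \<le> y \<Longrightarrow> clamp_to a b x \<le> clamp_to a b y"
    and "x \<le> y \<Longrightarrow> clamp_to a b y - clamp_to a b x \<le> y - x"
    and "x \<in> {a..b} \<Longrightarrow> clamp_to a b x = x"
    and "x \<le> a \<Longrightarrow> clamp_to a b x = a"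
  using assms by (auto simp: clamp_to_def)

lemma abs_contE:
  assumes "abs_cont f" "\<epsilon> > 0"
  obtains \<delta> where "\<delta> > 0"
    and "\<And>(I::int set) u v. finite I \<Longrightarrow> (\<And>i. i \<in> I \<Longrightarrow> u i \<le> v i) \<Longrightarrow>
        disjoint_family_on (\<lambda>i. {u i<..<v i}) I \<Longrightarrow> (\<Sum>i\<in>I. v i - u i) < \<delta> \<Longrightarrow>
        (\<Sum>i\<in>I. \<bar>f (v i) - f (u i)\<bar>) < \<epsilon>"
  using assms unfolding abs_cont_def by meson

lemma abs_contI:
  assumes "\<And>\<epsilon>. \<epsilon> > 0 \<Longrightarrow> \<exists>\<delta>>0. \<forall>(I::int set) u v. finite I \<longrightarrow> (\<forall>i\<in>I. u i \<le> v i) \<longrightarrow>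
        disjoint_family_on (\<lambda>i. {u i<..<v i}) I \<longrightarrow> (\<Sum>i\<in>I. v i - u i) < \<delta> \<longrightarrow>
        (\<Sum>i\<in>I. \<bar>f (v i) - f (u i)\<bar>) < \<epsilon>"
  shows "abs_cont f"
  using assms unfolding abs_cont_def by meson

text \<open>Clamping maps every interval to a subinterval of \<open>{a..b}\<close> that is contained in it or degenerate, so
disjointness and the bound on the total length survive.\<close>

lemma abs_cont_clamp:
  assumes ab: "a \<le> b" and f: "absolutely_continuous_interval a b f"
  shows "abs_cont (\<lambda>x. f (clamp_to a b x))"
proof (rule abs_contI)
  fix \<epsilon> :: real assume "\<epsilon> > 0"
  then obtain \<delta> where \<delta>: "\<delta> > 0"
    "\<And>(n::nat) u v. (\<forall>i<n. a \<le> u i \<and> u i \<le> v i \<and> v i \<le> b) \<Longrightarrow>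
        disjoint_family_on (\<lambda>i. {u i<..<v i}) {..<n} \<Longrightarrow> (\<Sum>i<n. v i - u i) < \<delta>
        \<Longrightarrow> (\<Sum>i<n. \<bar>f (v i) - f (u i)\<bar>) < \<epsilon>"
    using f unfolding absolutely_continuous_interval_def by meson
  have "(\<Sum>i\<in>I. \<bar>f (clamp_to a b (v i)) - f (clamp_to a b (u i))\<bar>) < \<epsilon>"
    if I: "finite I" "\<forall>i\<in>I. u i \<le> v i" "disjoint_family_on (\<lambda>i. {u i<..<v i}) I"
      "(\<Sum>i\<in>I. v i - u i) < \<delta>" for I :: "int set" and u v
  proof -
    obtain e where e: "bij_betw e {..<card I} I"
      using ex_bij_betw_nat_finite[OF \<open>finite I\<close>] by (auto simp: atLeast0LessThan)
    let ?c = "clamp_to a b"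
    let ?u = "\<lambda>j. ?c (u (e j))" and ?v = "\<lambda>j. ?c (v (e j))"
    have eI: "e j \<in> I" if "j < card I" for j
      using e that by (auto simp: bij_betw_def)
    have sub: "{?u j<..<?v j} \<subseteq> {u (e j)<..<v (e j)}" for j
      using ab by (auto simp: clamp_to_def)
    have "disjoint_family_on (\<lambda>j. {u (e j)<..<v (e j)}) {..<card I}"
      using I(3) e unfolding disjoint_family_on_def bij_betw_def inj_on_def by blast
    then have dj: "disjoint_family_on (\<lambda>j. {?u j<..<?v j}) {..<card I}"
      using sub unfolding disjoint_family_on_def by blast
    have "(\<Sum>j<card I. ?v j - ?u j) \<le> (\<Sum>j<card I. v (e j) - u (e j))"
      using I(2) eI clamp_to_props(3)[OF ab] by (intro sum_mono) auto
    also have "\<dots> = (\<Sum>i\<in>I. v i - u i)"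
      by (rule sum.reindex_bij_betw[OF e])
    finally have len: "(\<Sum>j<card I. ?v j - ?u j) < \<delta>" using I(4) by simp
    have "\<forall>j<card I. a \<le> ?u j \<and> ?u j \<le> ?v j \<and> ?v j \<le> b"
      using I(2) eI clamp_to_props(1,2)[OF ab] by auto
    from \<delta>(2)[OF this dj len]
    show ?thesis
      using sum.reindex_bij_betw[OF e, of "\<lambda>i. \<bar>f (?c (v i)) - f (?c (u i))\<bar>"] by simp
  qed
  then show "\<exists>\<delta>>0. \<forall>(I::int set) u v. finite I \<longrightarrow> (\<forall>i\<in>I. u i \<le> v i) \<longrightarrow>
        disjoint_family_on (\<lambda>i. {u i<..<v i}) I \<longrightarrow> (\<Sum>i\<in>I. v i - u i) < \<delta> \<longrightarrow>
        (\<Sum>i\<in>I. \<bar>f (clamp_to a b (v i)) - f (clamp_to a b (u i))\<bar>) < \<epsilon>"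
    using \<delta>(1) by blast
qed

text \<open>The common source of the closure properties below: absolute continuity only sees the size of
increments.\<close>

lemma abs_cont_dominated:
  assumes g: "abs_cont g" and k: "abs_cont k"
    and le: "\<And>x y. x \<le> y \<Longrightarrow> \<bar>f y - f x\<bar> \<le> C * (\<bar>g y - g x\<bar> + \<bar>k y - k x\<bar>)"
  shows "abs_cont f"
proof (rule abs_contI)
  fix \<epsilon> :: real assume "\<epsilon> > 0"
  define D where "D = \<bar>C\<bar> + 1"
  have D: "D > 0" "C \<le> D" by (auto simp: D_def)
  then have e: "\<epsilon> / (2 * D) > 0" using \<open>\<epsilon> > 0\<close> by simp
  obtain d1 where d1: "d1 > 0" "\<And>(I::int set) u v. finite I \<Longrightarrow> (\<And>i. i \<in> I \<Longrightarrow> u i \<le> v i) \<Longrightarrow>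
        disjoint_family_on (\<lambda>i. {u i<..<v i}) I \<Longrightarrow> (\<Sum>i\<in>I. v i - u i) < d1 \<Longrightarrow>
        (\<Sum>i\<in>I. \<bar>g (v i) - g (u i)\<bar>) < \<epsilon> / (2 * D)"
    using abs_contE[OF g e] by blast
  obtain d2 where d2: "d2 > 0" "\<And>(I::int set) u v. finite I \<Longrightarrow> (\<And>i. i \<in> I \<Longrightarrow> u i \<le> v i) \<Longrightarrow>
        disjoint_family_on (\<lambda>i. {u i<..<v i}) I \<Longrightarrow> (\<Sum>i\<in>I. v i - u i) < d2 \<Longrightarrow>
        (\<Sum>i\<in>I. \<bar>k (v i) - k (u i)\<bar>) < \<epsilon> / (2 * D)"
    using abs_contE[OF k e] by blast
  have "(\<Sum>i\<in>I. \<bar>f (v i) - f (u i)\<bar>) < \<epsilon>"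
    if I: "finite I" "\<forall>i\<in>I. u i \<le> v i" "disjoint_family_on (\<lambda>i. {u i<..<v i}) I"
      "(\<Sum>i\<in>I. v i - u i) < min d1 d2" for I :: "int set" and u v
  proof -
    have "(\<Sum>i\<in>I. \<bar>f (v i) - f (u i)\<bar>) \<le> (\<Sum>i\<in>I. D * (\<bar>g (v i) - g (u i)\<bar> + \<bar>k (v i) - k (u i)\<bar>))"
    proof (rule sum_mono)
      fix i assume "i \<in> I"
      then have "\<bar>f (v i) - f (u i)\<bar> \<le> C * (\<bar>g (v i) - g (u i)\<bar> + \<bar>k (v i) - k (u i)\<bar>)"
        using le I(2) by blast
      also have "\<dots> \<le> D * (\<bar>g (v i) - g (u i)\<bar> + \<bar>k (v i) - k (u i)\<bar>)"
        using D by (intro mult_right_mono) auto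
      finally show "\<bar>f (v i) - f (u i)\<bar> \<le> \<dots>" .
    qed
    also have "\<dots> = D * ((\<Sum>i\<in>I. \<bar>g (v i) - g (u i)\<bar>) + (\<Sum>i\<in>I. \<bar>k (v i) - k (u i)\<bar>))"
      by (simp add: sum.distrib flip: sum_distrib_left)
    also have "\<dots> < D * (\<epsilon> / (2 * D) + \<epsilon> / (2 * D))"
      using D I d1(2)[of I u v] d2(2)[of I u v] by (intro mult_strict_left_mono add_strict_mono) auto
    also have "\<dots> = \<epsilon>" using D by (simp add: field_simps)
    finally show ?thesis .
  qed
  then show "\<exists>\<delta>>0. \<forall>(I::int set) u v. finite I \<longrightarrow> (\<forall>i\<in>I. u i \<le> v i) \<longrightarrow>
        disjoint_family_on (\<lambda>i. {u i<..<v i}) I \<longrightarrow> (\<Sum>i\<in>I. v i - u i) < \<delta> \<longrightarrow>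
        (\<Sum>i\<in>I. \<bar>f (v i) - f (u i)\<bar>) < \<epsilon>"
    using d1(1) d2(1) by (intro exI[of _ "min d1 d2"]) auto
qed

lemma abs_cont_mult:
  assumes "abs_cont g" "abs_cont k" "\<And>x. \<bar>g x\<bar> \<le> B" "\<And>x. \<bar>k x\<bar> \<le> B"
  shows "abs_cont (\<lambda>x. g x * k x)"
proof (rule abs_cont_dominated[OF assms(1,2), of _ B])
  fix x y
  have "g y * k y - g x * k x = k y * (g y - g x) + g x * (k y - k x)"
    by (simp add: algebra_simps)
  then have "\<bar>g y * k y - g x * k x\<bar> \<le> \<bar>k y\<bar> * \<bar>g y - g x\<bar> + \<bar>g x\<bar> * \<bar>k y - k x\<bar>"
    by (metis abs_mult abs_triangle_ineq)
  also have "\<dots> \<le> B * \<bar>g y - g x\<bar> + B * \<bar>k y - k x\<bar>"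
    using assms(3)[of x] assms(4)[of y] by (intro add_mono mult_right_mono) auto
  finally show "\<bar>g y * k y - g x * k x\<bar> \<le> B * (\<bar>g y - g x\<bar> + \<bar>k y - k x\<bar>)"
    by (simp add: distrib_left)
qed

lemma abs_cont_Lipschitz:
  assumes "abs_cont g" "\<And>x y. \<bar>f y - f x\<bar> \<le> C * \<bar>g y - g x\<bar>"
  shows "abs_cont f"
proof (rule abs_cont_dominated[OF assms(1,1), of _ "\<bar>C\<bar>"])
  fix x y
  have "\<bar>f y - f x\<bar> \<le> C * \<bar>g y - g x\<bar>" by (rule assms(2))
  also have "\<dots> \<le> \<bar>C\<bar> * (\<bar>g y - g x\<bar> + \<bar>g y - g x\<bar>)"
    by (intro mult_mono) auto
  finally show "\<bar>f y - f x\<bar> \<le> \<bar>C\<bar> * (\<bar>g y - g x\<bar> + \<bar>g y - g x\<bar>)" .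
qed

lemma abs_cont_add: "abs_cont g \<Longrightarrow> abs_cont k \<Longrightarrow> abs_cont (\<lambda>x. g x + k x)"
  by (rule abs_cont_dominated[of g k _ 1]) auto

lemma abs_cont_diff: "abs_cont g \<Longrightarrow> abs_cont k \<Longrightarrow> abs_cont (\<lambda>x. g x - k x)"
  by (rule abs_cont_dominated[of g k _ 1]) auto

lemma abs_cont_imp_continuous:
  assumes "abs_cont f"
  shows "continuous_on UNIV f"
  unfolding continuous_on_iff
proof (intro ballI allI impI)
  fix x e :: real assume "0 < e"
  obtain d where d: "d > 0" "\<And>(I::int set) u v. finite I \<Longrightarrow> (\<And>i. i \<in> I \<Longrightarrow> u i \<le> v i) \<Longrightarrow>
        disjoint_family_on (\<lambda>i. {u i<..<v i}) I \<Longrightarrow> (\<Sum>i\<in>I. v i - u i) < d \<Longrightarrow>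
        (\<Sum>i\<in>I. \<bar>f (v i) - f (u i)\<bar>) < e"
    using abs_contE[OF assms \<open>0 < e\<close>] by blast
  have *: "\<bar>f z - f y\<bar> < e" if "y \<le> z" "z - y < d" for y z
    using d(2)[of "{0}" "\<lambda>_. y" "\<lambda>_. z"] that by (simp add: disjoint_family_on_def)
  have "dist (f y) (f x) < e" if "dist y x < d" for y
    using *[of x y] *[of y x] that by (cases "x \<le> y") (auto simp: dist_real_def abs_minus_commute)
  then show "\<exists>d>0. \<forall>y\<in>UNIV. dist y x < d \<longrightarrow> dist (f y) (f x) < e"
    using d(1) by blast
qed

section \<open>A monotone majorant of an absolutely continuous function\<close>

text \<open>The variation of \<open>f\<close> over the cells of length \<open>1 / 2^n\<close> between \<open>a\<close> and \<open>x\<close>. It is used for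
functions that are constant to the left of \<open>a\<close>, for which it does not matter where the sum starts.\<close>

definition dyadic_variation :: "(real \<Rightarrow> real) \<Rightarrow> real \<Rightarrow> nat \<Rightarrow> real \<Rightarrow> real" where
  "dyadic_variation f a n x =
     (\<Sum>k\<in>{\<lfloor>2^n * a\<rfloor>..<\<lfloor>2^n * x\<rfloor>}. \<bar>f (of_int (k+1) / 2^n) - f (of_int k / 2^n)\<bar>)"

lemma floor_pow_mono: "(x::real) \<le> y \<Longrightarrow> \<lfloor>2^n * x\<rfloor> \<le> \<lfloor>2^n * y\<rfloor>"
  by (intro floor_mono) simp

lemma dyadic_variation_diff:
  assumes const: "\<forall>x\<le>a. f x = f a" and xy: "x \<le> y"
  shows "dyadic_variation f a n y - dyadic_variation f a n x =
     (\<Sum>k\<in>{\<lfloor>2^n * x\<rfloor>..<\<lfloor>2^n * y\<rfloor>}. \<bar>f (of_int (k+1) / 2^n) - f (of_int k / 2^n)\<bar>)"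
proof -
  define D where "D k = \<bar>f (of_int (k+1) / 2^n) - f (of_int k / 2^n)\<bar>" for k :: int
  define m l r where mlr: "m = \<lfloor>2^n * a\<rfloor>" "l = \<lfloor>2^n * x\<rfloor>" "r = \<lfloor>2^n * y\<rfloor>"
  have lr: "l \<le> r" unfolding mlr by (rule floor_pow_mono[OF xy])
  have D0: "D k = 0" if "k < m" for k
  proof -
    have "of_int (k + 1) \<le> 2^n * a" using that unfolding mlr by linarith
    moreover have "of_int k \<le> 2^n * a" using that unfolding mlr by linarith
    ultimately have "of_int (k+1) / 2^n \<le> a" "of_int k / 2^n \<le> a"
      by (simp_all add: field_simps)
    then have "f (of_int (k+1) / 2^n) = f a" "f (of_int k / 2^n) = f a"
      using const by blast+
    then show ?thesis unfolding D_def by simp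
  qed
  have "sum D {m..<r} = sum D {m..<l} + sum D {l..<r}"
  proof (cases "m \<le> l")
    case True
    then have "{m..<r} = {m..<l} \<union> {l..<r}" using lr by auto
    then show ?thesis by (simp add: sum.union_disjoint)
  next
    case False
    then have "sum D {l..<r} = sum D {m..<r}"
      using D0 by (intro sum.mono_neutral_right) auto
    then show ?thesis using False by simp
  qed
  then show ?thesis unfolding dyadic_variation_def D_def mlr by simp
qed

lemma dyadic_variation_mono:
  assumes "x \<le> y"
  shows "dyadic_variation f a n x \<le> dyadic_variation f a n y"
  unfolding dyadic_variation_def
  using floor_pow_mono[OF assms, of n] by (intro sum_mono2) auto

text \<open>Every cell splits into two cells of the next level, and the triangle inequality applies. The
starting point is an integer so that it is a grid point of every level.\<close>

lemma dyadic_variation_Suc: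
  assumes const: "\<forall>x\<le>of_int a. f x = f (of_int a)"
  shows "dyadic_variation f (of_int a) n x \<le> dyadic_variation f (of_int a) (Suc n) x"
proof -
  define m r where mr: "m = 2^n * a" "r = \<lfloor>2^n * x\<rfloor>"
  define E where "E k = \<bar>f (of_int (k+1) / 2^Suc n) - f (of_int k / 2^Suc n)\<bar>" for k :: int
  have m: "\<lfloor>2^n * of_int a :: real\<rfloor> = m" "\<lfloor>2^Suc n * of_int a :: real\<rfloor> = 2 * m"
    unfolding mr by (metis floor_of_int of_int_mult of_int_numeral of_int_power, 
        metis floor_of_int of_int_mult of_int_numeral of_int_power mult.assoc power_Suc)
  have r2: "2 * r \<le> \<lfloor>2^Suc n * x\<rfloor>"
    unfolding mr by (simp add: le_floor_iff)
  have "dyadic_variation f (of_int a) n x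
      = (\<Sum>k\<in>{m..<r}. \<bar>f (of_int (k+1) / 2^n) - f (of_int k / 2^n)\<bar>)"
    unfolding dyadic_variation_def m mr(2)[symmetric] ..
  also have "\<dots> \<le> (\<Sum>k\<in>{m..<r}. E (2*k) + E (2*k+1))"
  proof (rule sum_mono)
    fix k
    have e: "of_int (2*k+1+1) / 2^Suc n = (of_int (k+1) / 2^n :: real)"
      "of_int (2*k) / 2^Suc n = (of_int k / 2^n :: real)" by (simp_all add: field_simps)
    show "\<bar>f (of_int (k+1) / 2^n) - f (of_int k / 2^n)\<bar> \<le> E (2*k) + E (2*k+1)"
      unfolding E_def e by linarith
  qed
  also have "\<dots> = (\<Sum>k\<in>{2*m..<2*r}. E k)"
  proof -
    have "{2*m..<2*r} = (\<lambda>k. 2*k) ` {m..<r} \<union> (\<lambda>k. 2*k+1) ` {m..<r}" (is "?L = ?R")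
    proof
      show "?L \<subseteq> ?R"
      proof
        fix k assume k: "k \<in> ?L"
        have "k = 2 * (k div 2) \<or> k = 2 * (k div 2) + 1" by presburger
        moreover have "k div 2 \<in> {m..<r}" using k by auto
        ultimately show "k \<in> ?R" by blast
      qed
    qed auto
    moreover have "(\<lambda>k. 2*k) ` {m..<r} \<inter> (\<lambda>k. 2*k+1) ` {m..<r} = {}"
      by auto presburger
    ultimately have "sum E {2*m..<2*r} = sum E ((\<lambda>k. 2*k) ` {m..<r}) + sum E ((\<lambda>k. 2*k+1) ` {m..<r})"
      by (simp add: sum.union_disjoint)
    also have "\<dots> = (\<Sum>k\<in>{m..<r}. E (2*k)) + (\<Sum>k\<in>{m..<r}. E (2*k+1))"
      by (simp add: sum.reindex inj_on_def)
    finally show ?thesis by (simp add: sum.distrib)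
  qed
  also have "\<dots> \<le> (\<Sum>k\<in>{2*m..<\<lfloor>2^Suc n * x\<rfloor>}. E k)"
    using r2 by (intro sum_mono2) (auto simp: E_def)
  also have "\<dots> = dyadic_variation f (of_int a) (Suc n) x"
    unfolding dyadic_variation_def m E_def ..
  finally show ?thesis .
qed

lemma card_dyadic_cells:
  assumes "(u::real) \<le> v"
  shows "real (card {\<lfloor>2^n * u\<rfloor>..<\<lfloor>2^n * v\<rfloor>}) / 2^n \<le> (v - u) + 1 / 2^n"
proof -
  have "real (card {\<lfloor>2^n * u\<rfloor>..<\<lfloor>2^n * v\<rfloor>}) = of_int (\<lfloor>2^n * v\<rfloor> - \<lfloor>2^n * u\<rfloor>)"
    using floor_pow_mono[OF assms, of n] by simp
  also have "\<dots> \<le> 2^n * v - 2^n * u + 1" by linarith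
  finally show ?thesis by (simp add: field_simps)
qed

lemma disjoint_dyadic_cells:
  "disjoint_family_on (\<lambda>k. {of_int k / 2^n <..< (of_int (k+1) / 2^n :: real)}) (S :: int set)"
proof -
  have "{of_int k / 2^n <..< (of_int (k+1) / 2^n :: real)} \<inter> {of_int l / 2^n <..< of_int (l+1) / 2^n} = {}"
    if "k < l" for k l :: int
  proof -
    have "of_int (k+1) \<le> (of_int l :: real)" using that by simp
    then have "of_int (k+1) / 2^n \<le> (of_int l / 2^n :: real)"
      by (simp only: divide_right_mono zero_le_power zero_le_numeral)
    then show ?thesis by auto
  qed
  then show ?thesis unfolding disjoint_family_on_def by (metis Int_commute linorder_neqE)
qed

text \<open>The cells counted by the increments over disjoint intervals are distinct, and their total length
exceeds that of the intervals by at most one cell for each interval. So the modulus of absolute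
continuity of \<open>f\<close> also works, up to an error that vanishes as \<open>n\<close> grows, for its dyadic variation.\<close>

lemma dyadic_variation_small:
  fixes I :: "int set"
  assumes const: "\<forall>x\<le>a. f x = f a"
    and \<delta>: "\<And>(I::int set) u v. finite I \<Longrightarrow> (\<And>i. i \<in> I \<Longrightarrow> u i \<le> v i) \<Longrightarrow>
        disjoint_family_on (\<lambda>i. {u i<..<v i}) I \<Longrightarrow> (\<Sum>i\<in>I. v i - u i) < \<delta> \<Longrightarrow>
        (\<Sum>i\<in>I. \<bar>f (v i) - f (u i)\<bar>) < \<epsilon>"
    and I: "finite I" "\<And>i. i \<in> I \<Longrightarrow> u i \<le> v i" "disjoint_family_on (\<lambda>i. {u i<..<v i}) I"
    and len: "(\<Sum>i\<in>I. v i - u i) + card I / 2^n < \<delta>"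
  shows "(\<Sum>i\<in>I. dyadic_variation f a n (v i) - dyadic_variation f a n (u i)) < \<epsilon>"
proof -
  define R where "R i = {\<lfloor>2^n * u i\<rfloor>..<\<lfloor>2^n * v i\<rfloor>}" for i
  define D where "D k = \<bar>f (of_int (k+1) / 2^n) - f (of_int k / 2^n)\<bar>" for k :: int
  have disj: "R i \<inter> R j = {}" if "i \<in> I" "j \<in> I" "i \<noteq> j" for i j
  proof -
    have *: "u i \<ge> v i \<or> u j \<ge> v j \<or> v i \<le> u j \<or> v j \<le> u i"
    proof (rule ccontr)
      assume "\<not> ?thesis"
      then have "max (u i) (u j) < min (v i) (v j)" by auto
      then obtain z where "max (u i) (u j) < z" "z < min (v i) (v j)" using dense by blast
      then have "z \<in> {u i<..<v i} \<inter> {u j<..<v j}" by auto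
      then show False using I(3) that unfolding disjoint_family_on_def by blast
    qed
    then show ?thesis
      using floor_pow_mono[of "v i" "u i" n] floor_pow_mono[of "v j" "u j" n]
        floor_pow_mono[of "v i" "u j" n] floor_pow_mono[of "v j" "u i" n]
      unfolding R_def by auto
  qed
  have fin: "finite (\<Union>i\<in>I. R i)" using I(1) by (auto simp: R_def)
  have "(\<Sum>i\<in>I. dyadic_variation f a n (v i) - dyadic_variation f a n (u i)) = (\<Sum>i\<in>I. sum D (R i))"
    using I(2) dyadic_variation_diff[OF const] unfolding D_def R_def by (intro sum.cong) auto
  also have "\<dots> = sum D (\<Union>i\<in>I. R i)"
    using disj I(1) by (subst sum.UNION_disjoint) (auto simp: R_def)
  also have "\<dots> < \<epsilon>"
    unfolding D_def
  proof (rule \<delta>[OF fin])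
    show "disjoint_family_on (\<lambda>k. {of_int k / 2^n <..< (of_int (k+1) / 2^n :: real)}) (\<Union>i\<in>I. R i)"
      by (rule disjoint_dyadic_cells)
    show "of_int k / 2^n \<le> (of_int (k+1) / 2^n :: real)" for k
      by (simp add: divide_right_mono)
    have "(\<Sum>k\<in>(\<Union>i\<in>I. R i). of_int (k+1) / 2^n - of_int k / 2^n :: real) = (\<Sum>k\<in>(\<Union>i\<in>I. R i). 1 / 2^n)"
      by (intro sum.cong) (auto simp: field_simps)
    also have "\<dots> = real (card (\<Union>i\<in>I. R i)) / 2^n" by simp
    also have "real (card (\<Union>i\<in>I. R i)) = (\<Sum>i\<in>I. real (card (R i)))"
      using disj I(1) by (subst card_UN_disjoint) (auto simp: R_def)
    also have "(\<Sum>i\<in>I. real (card (R i))) / 2^n = (\<Sum>i\<in>I. real (card (R i)) / 2^n)"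
      by (rule sum_divide_distrib)
    also have "\<dots> \<le> (\<Sum>i\<in>I. (v i - u i) + 1 / 2^n)"
      unfolding R_def using I(2) card_dyadic_cells by (intro sum_mono) auto
    also have "\<dots> = (\<Sum>i\<in>I. v i - u i) + card I / 2^n" by (simp add: sum.distrib)
    finally show "(\<Sum>k\<in>(\<Union>i\<in>I. R i). of_int (k+1) / 2^n - of_int k / 2^n :: real) < \<delta>" using len by linarith
  qed
  finally show ?thesis .
qed

lemma inverse_two_power_small: "c > 0 \<Longrightarrow> \<forall>\<^sub>F n in sequentially. K / 2^n < (c::real)"
proof -
  assume "c > 0"
  have "(\<lambda>n. K * (1/2)^n) \<longlonglongrightarrow> K * 0"
    by (intro tendsto_intros) (simp add: LIMSEQ_power_zero)
  then show ?thesis using \<open>c > 0\<close> order_tendstoD(2)[of "\<lambda>n. K * (1/2)^n" 0 sequentially c]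
    by (simp add: power_divide)
qed

text \<open>Over steps of half the length \<open>\<delta>\<close> that belongs to \<open>\<epsilon> = 1\<close>, a sufficiently fine dyadic variation
grows by at most 1.\<close>

lemma dyadic_variation_bounded:
  assumes f: "abs_cont f" and const: "\<forall>x\<le>of_int a. f x = f (of_int a)"
  shows "\<exists>B. \<forall>n. dyadic_variation f (of_int a) n x \<le> B"
proof -
  let ?V = "dyadic_variation f (of_int a)"
  obtain \<delta> where \<delta>: "\<delta> > 0" "\<And>(I::int set) u v. finite I \<Longrightarrow> (\<And>i. i \<in> I \<Longrightarrow> u i \<le> v i) \<Longrightarrow>
        disjoint_family_on (\<lambda>i. {u i<..<v i}) I \<Longrightarrow> (\<Sum>i\<in>I. v i - u i) < \<delta> \<Longrightarrow>
        (\<Sum>i\<in>I. \<bar>f (v i) - f (u i)\<bar>) < 1"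
    using abs_contE[OF f zero_less_one] by blast
  have "\<forall>\<^sub>F n in sequentially. 1 / 2^n < \<delta> / 2"
    using inverse_two_power_small[of "\<delta>/2" 1] \<delta>(1) by simp
  then obtain N where N: "\<And>n. n \<ge> N \<Longrightarrow> 1 / 2^n < \<delta> / 2"
    by (auto simp: eventually_sequentially)
  have inc: "incseq (\<lambda>n. ?V n x)" for x
    by (rule incseq_SucI) (rule dyadic_variation_Suc[OF const])
  have step: "?V n y - ?V n x < 1" if "n \<ge> N" "x \<le> y" "y - x \<le> \<delta> / 2" for n x y
  proof -
    have "(\<Sum>i\<in>{0::int}. ?V n y - ?V n x) < 1"
    proof (rule dyadic_variation_small[OF const \<delta>(2)])
      have "(y - x) + 1 / 2^n < \<delta>" using N[OF that(1)] that(3) by linarith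
      then show "(\<Sum>i\<in>{0::int}. y - x) + real (card {0::int}) / 2^n < \<delta>"
        by (simp only: sum.insert sum.empty finite.emptyI empty_iff card_1_singleton_iff not_False_eq_True
            card.insert card.empty One_nat_def[symmetric] add_0_right of_nat_1)
    qed (use that(2) in \<open>auto simp: disjoint_family_on_def\<close>)
    then show ?thesis by simp
  qed
  have bd: "?V n (of_int a + real j * (\<delta> / 2)) \<le> real j" if "n \<ge> N" for n j
  proof (induction j)
    case 0
    then show ?case by (simp add: dyadic_variation_def)
  next
    case (Suc j)
    have "?V n (of_int a + real (Suc j) * (\<delta> / 2)) - ?V n (of_int a + real j * (\<delta> / 2)) < 1"
    proof (rule step[OF that])
      show "of_int a + real j * (\<delta> / 2) \<le> of_int a + real (Suc j) * (\<delta> / 2)"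
        using \<delta>(1) by (intro add_left_mono mult_right_mono) auto
      show "of_int a + real (Suc j) * (\<delta> / 2) - (of_int a + real j * (\<delta> / 2)) \<le> \<delta> / 2"
        by (simp add: field_simps)
    qed
    then show ?case using Suc by linarith
  qed
  have "0 < \<delta> / 2" using \<delta>(1) by simp
  then obtain j where j: "x - of_int a < real j * (\<delta> / 2)"
    using reals_Archimedean3 by blast
  have "?V n x \<le> real j" for n
  proof -
    have "?V n x \<le> ?V (max n N) x"
      using inc by (simp add: incseq_def)
    also have "\<dots> \<le> ?V (max n N) (of_int a + real j * (\<delta> / 2))"
      using j by (intro dyadic_variation_mono) auto
    also have "\<dots> \<le> real j" by (rule bd) simp
    finally show ?thesis .
  qed
  then show ?thesis by blast
qed

text \<open>The majorant is the limit of the dyadic variations. This replaces the total variation over all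
partitions: the increments of the limit over disjoint intervals are limits of sums over dyadic
cells, so that absolute continuity carries over directly.\<close>

lemma abs_cont_monotone_majorant:
  assumes f: "abs_cont f" and const: "\<forall>x\<le>a. f x = f a"
  obtains V where "mono V" "abs_cont V" "\<And>x y. x \<le> y \<Longrightarrow> \<bar>f y - f x\<bar> \<le> V y - V x"
proof -
  define A where "A = \<lfloor>a\<rfloor>"
  have constA: "\<forall>x\<le>of_int A. f x = f (of_int A)"
  proof (intro allI impI)
    fix x assume that: "x \<le> real_of_int A"
    have "x \<le> a" "of_int A \<le> a" using that unfolding A_def by linarith+
    then show "f x = f (of_int A)" using const[rule_format, of x] const[rule_format, of "of_int A"] by presburger
  qed
  define Vn where "Vn = dyadic_variation f (of_int A)"
  define V where "V x = lim (\<lambda>n. Vn n x)" for x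
  have inc: "incseq (\<lambda>n. Vn n x)" for x
    unfolding Vn_def by (rule incseq_SucI) (rule dyadic_variation_Suc[OF constA])
  have lim: "(\<lambda>n. Vn n x) \<longlonglongrightarrow> V x" for x
  proof -
    obtain B where "\<forall>n. Vn n x \<le> B"
      using dyadic_variation_bounded[OF f constA] unfolding Vn_def by blast
    then show ?thesis using incseq_convergent[OF inc[of x]] unfolding V_def
      by (metis limI)
  qed
  have mono: "mono V"
  proof (rule monoI)
    fix x y :: real assume "x \<le> y"
    then show "V x \<le> V y"
      by (intro LIMSEQ_le[OF lim lim]) (auto simp: Vn_def dyadic_variation_mono)
  qed
  moreover have "abs_cont V"
  proof (rule abs_contI)
    fix \<epsilon> :: real assume "\<epsilon> > 0"
    then have "\<epsilon>/2 > 0" by simp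
    obtain \<delta> where \<delta>: "\<delta> > 0" "\<And>(I::int set) u v. finite I \<Longrightarrow> (\<And>i. i \<in> I \<Longrightarrow> u i \<le> v i) \<Longrightarrow>
        disjoint_family_on (\<lambda>i. {u i<..<v i}) I \<Longrightarrow> (\<Sum>i\<in>I. v i - u i) < \<delta> \<Longrightarrow>
        (\<Sum>i\<in>I. \<bar>f (v i) - f (u i)\<bar>) < \<epsilon>/2"
      using abs_contE[OF f \<open>\<epsilon>/2 > 0\<close>] by blast
    have "(\<Sum>i\<in>I. \<bar>V (v i) - V (u i)\<bar>) < \<epsilon>"
      if I: "finite I" "\<forall>i\<in>I. u i \<le> v i" "disjoint_family_on (\<lambda>i. {u i<..<v i}) I"
        "(\<Sum>i\<in>I. v i - u i) < \<delta>" for I :: "int set" and u v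
    proof -
      have "(\<Sum>i\<in>I. V (v i) - V (u i)) \<le> \<epsilon>/2"
      proof (rule tendsto_upperbound)
        show "(\<lambda>n. \<Sum>i\<in>I. Vn n (v i) - Vn n (u i)) \<longlonglongrightarrow> (\<Sum>i\<in>I. V (v i) - V (u i))"
          by (intro tendsto_sum tendsto_diff lim)
        have "\<forall>\<^sub>F n in sequentially. card I / 2^n < \<delta> - (\<Sum>i\<in>I. v i - u i)"
          using I(4) by (intro inverse_two_power_small) simp
        then show "\<forall>\<^sub>F n in sequentially. (\<Sum>i\<in>I. Vn n (v i) - Vn n (u i)) \<le> \<epsilon>/2"
        proof eventually_elim
          case (elim n)
          then have "(\<Sum>i\<in>I. v i - u i) + card I / 2^n < \<delta>" by linarith
          from dyadic_variation_small[OF constA \<delta>(2) I(1) _ I(3) this] I(2)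
          show ?case unfolding Vn_def by force
        qed
      qed simp
      moreover have "(\<Sum>i\<in>I. \<bar>V (v i) - V (u i)\<bar>) = (\<Sum>i\<in>I. V (v i) - V (u i))"
        using I(2) monoD[OF mono] by (intro sum.cong) auto
      ultimately show ?thesis using \<open>\<epsilon> > 0\<close> by simp
    qed
    then show "\<exists>\<delta>>0. \<forall>(I::int set) u v. finite I \<longrightarrow> (\<forall>i\<in>I. u i \<le> v i) \<longrightarrow>
        disjoint_family_on (\<lambda>i. {u i<..<v i}) I \<longrightarrow> (\<Sum>i\<in>I. v i - u i) < \<delta> \<longrightarrow>
        (\<Sum>i\<in>I. \<bar>V (v i) - V (u i)\<bar>) < \<epsilon>"
      using \<delta>(1) by blast
  qed
  moreover have "\<bar>f y - f x\<bar> \<le> V y - V x" if xy: "x \<le> y" for x y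
  proof -
    have approx: "(\<lambda>n. f (of_int \<lfloor>2^n * x\<rfloor> / 2^n)) \<longlonglongrightarrow> f x" for x
    proof -
      have "(\<lambda>n. of_int \<lfloor>2^n * x\<rfloor> / 2^n) \<longlonglongrightarrow> x"
      proof (rule tendsto_sandwich)
        show "\<forall>\<^sub>F n in sequentially. x - (1/2)^n \<le> of_int \<lfloor>2^n * x\<rfloor> / 2^n"
        proof (rule always_eventually, rule allI)
          fix n :: nat
          have "2^n * x - 1 \<le> of_int \<lfloor>2^n * x\<rfloor>" by linarith
          then have "(2^n * x - 1) / 2^n \<le> of_int \<lfloor>2^n * x\<rfloor> / 2^n"
            by (intro divide_right_mono) auto
          moreover have "(2^n * x - 1) / 2^n = x - (1/2)^n"
            by (simp add: diff_divide_distrib power_divide)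
          ultimately show "x - (1/2)^n \<le> of_int \<lfloor>2^n * x\<rfloor> / 2^n" by (simp only:)
        qed
        show "\<forall>\<^sub>F n in sequentially. of_int \<lfloor>2^n * x\<rfloor> / 2^n \<le> x"
          by (rule always_eventually) (simp add: field_simps)
        have "(\<lambda>n. x - (1/2)^n) \<longlonglongrightarrow> x - 0"
          by (intro tendsto_intros LIMSEQ_power_zero) simp
        then show "(\<lambda>n. x - (1/2)^n) \<longlonglongrightarrow> x" by simp
      qed simp
      moreover have "isCont f x"
        using abs_cont_imp_continuous[OF f] by (simp add: continuous_on_eq_continuous_at)
      ultimately show ?thesis by (rule isCont_tendsto_compose[rotated])
    qed
    have tel: "\<bar>f (of_int r / 2^n) - f (of_int l / 2^n)\<bar>
        \<le> (\<Sum>k\<in>{l..<r}. \<bar>f (of_int (k+1) / 2^n) - f (of_int k / 2^n)\<bar>)"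
      if "l \<le> r" for l r :: int and n
      using that
    proof (induction r rule: int_ge_induct)
      case (step r)
      have "{l..<r+1} = insert r {l..<r}" using step by auto
      then show ?case using step by simp
    qed simp
    show ?thesis
    proof (rule LIMSEQ_le)
      show "(\<lambda>n. \<bar>f (of_int \<lfloor>2^n * y\<rfloor> / 2^n) - f (of_int \<lfloor>2^n * x\<rfloor> / 2^n)\<bar>) \<longlonglongrightarrow> \<bar>f y - f x\<bar>"
        by (intro tendsto_intros approx)
      show "(\<lambda>n. Vn n y - Vn n x) \<longlonglongrightarrow> V y - V x"
        by (intro tendsto_intros lim)
      show "\<exists>N. \<forall>n\<ge>N. \<bar>f (of_int \<lfloor>2^n * y\<rfloor> / 2^n) - f (of_int \<lfloor>2^n * x\<rfloor> / 2^n)\<bar> \<le> Vn n y - Vn n x"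
        unfolding Vn_def using dyadic_variation_diff[OF constA xy] tel[OF floor_pow_mono[OF xy]] by auto
    qed
  qed
  ultimately show thesis using that by blast
qed

section \<open>The fundamental theorem of calculus\<close>

lemma dyadic_cells_exhaust_open:
  fixes U :: "real set"
  assumes "open U" "x \<in> U"
  shows "\<forall>\<^sub>F n in sequentially. \<exists>k::int. \<bar>k\<bar> \<le> int n * 2^n \<and>
           {of_int k / 2^n..of_int (k+1) / 2^n} \<subseteq> U \<and> x \<in> {of_int k / 2^n..of_int (k+1) / 2^n}"
proof -
  obtain e where e: "e > 0" "ball x e \<subseteq> U" using assms by (auto simp: open_contains_ball)
  obtain m :: nat where m: "\<bar>x\<bar> + 1 \<le> real m" using real_arch_simple by blast
  show ?thesis
    using inverse_two_power_small[OF e(1), of 1] eventually_ge_at_top[of m]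
  proof eventually_elim
    case (elim n)
    define k where "k = \<lfloor>2^n * x\<rfloor>"
    have k: "of_int k \<le> 2^n * x" "2^n * x < of_int k + 1" unfolding k_def by linarith+
    have "\<bar>2^n * x\<bar> \<le> 2^n * (real m - 1)"
      using m by (simp add: abs_mult)
    then have "\<bar>of_int k :: real\<bar> \<le> 2^n * (real m - 1) + 1" using k by linarith
    also have "\<dots> \<le> real n * 2^n"
    proof -
      have "1 \<le> (2::real)^n" by simp
      moreover have "2^n * real m \<le> real n * 2^n"
        using elim(2) mult_right_mono[of "real m" "real n" "2^n"] by (simp add: mult.commute)
      ultimately show ?thesis unfolding right_diff_distrib by linarith
    qed
    finally have "of_int \<bar>k\<bar> \<le> (of_int (int n * 2^n) :: real)" by simp
    then have 1: "\<bar>k\<bar> \<le> int n * 2^n" using of_int_le_iff by blast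
    have 2: "of_int k / 2^n \<le> x" "x \<le> of_int (k+1) / 2^n" using k by (simp_all add: field_simps)
    have len: "of_int (k+1) / 2^n = (of_int k / 2^n + 1 / 2^n :: real)" by (simp add: add_divide_distrib)
    have "{of_int k / 2^n..of_int (k+1) / 2^n} \<subseteq> ball x e"
      using 2 elim(1) unfolding len by (auto simp: dist_real_def abs_if)
    then show ?case using 1 2 e(2) by (intro exI[of _ k]) auto
  qed
qed

text \<open>Absolute continuity speaks about finite families of intervals; an open set is exhausted by finite
unions of dyadic cells.\<close>

lemma mono_abs_cont_small_on_open:
  assumes mono: "mono H" and ac: "abs_cont H" and \<epsilon>: "\<epsilon> > 0"
  shows "\<exists>\<delta>>0. \<forall>U. open U \<longrightarrow> emeasure lborel U < ennreal \<delta> \<longrightarrow> emeasure (interval_measure H) U \<le> ennreal \<epsilon>"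
proof -
  let ?M = "interval_measure H"
  have cont: "continuous_on UNIV H" by (rule abs_cont_imp_continuous[OF ac])
  obtain \<delta> where \<delta>: "\<delta> > 0" "\<And>(I::int set) u v. finite I \<Longrightarrow> (\<And>i. i \<in> I \<Longrightarrow> u i \<le> v i) \<Longrightarrow>
        disjoint_family_on (\<lambda>i. {u i<..<v i}) I \<Longrightarrow> (\<Sum>i\<in>I. v i - u i) < \<delta> \<Longrightarrow>
        (\<Sum>i\<in>I. \<bar>H (v i) - H (u i)\<bar>) < \<epsilon>"
    using abs_contE[OF ac \<epsilon>] by blast
  have "emeasure ?M U \<le> ennreal \<epsilon>" if U: "open U" "emeasure lborel U < ennreal \<delta>" for U
  proof -
    define l r where "l n k = (of_int k / 2^n :: real)" and "r n k = (of_int (k+1) / 2^n :: real)"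
      for n :: nat and k :: int
    have lr: "l n k \<le> r n k" for n k unfolding l_def r_def by (simp add: divide_right_mono)
    define K where "K n = {k::int. \<bar>k\<bar> \<le> int n * 2^n \<and> {l n k..r n k} \<subseteq> U}" for n
    define W where "W n = (\<Union>k\<in>K n. {l n k..r n k})" for n
    have finK: "finite (K n)" for n
    proof (rule finite_subset)
      show "K n \<subseteq> {- (int n * 2^n)..int n * 2^n}" unfolding K_def by auto
    qed simp
    have small: "emeasure ?M (W n) \<le> ennreal \<epsilon>" for n
    proof -
      have dj: "disjoint_family_on (\<lambda>k. {l n k<..<r n k}) (K n)"
        unfolding l_def r_def by (rule disjoint_dyadic_cells)
      have "ennreal (\<Sum>k\<in>K n. r n k - l n k) = (\<Sum>k\<in>K n. emeasure lborel {l n k<..<r n k})"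
        using lr by (simp add: sum_ennreal)
      also have "\<dots> = emeasure lborel (\<Union>k\<in>K n. {l n k<..<r n k})"
        using dj finK by (intro sum_emeasure) auto
      also have "\<dots> \<le> emeasure lborel U"
        using U(1) by (intro emeasure_mono) (auto simp: K_def subset_iff)
      finally have "ennreal (\<Sum>k\<in>K n. r n k - l n k) < ennreal \<delta>" using U(2) by (rule le_less_trans)
      then have len: "(\<Sum>k\<in>K n. r n k - l n k) < \<delta>"
        by (rule ennreal_less_iff[THEN iffD1, rotated]) (use lr in \<open>auto intro: sum_nonneg\<close>)
      have "emeasure ?M (W n) \<le> (\<Sum>k\<in>K n. emeasure ?M {l n k..r n k})"
        unfolding W_def using finK by (intro emeasure_subadditive_finite) auto
      also have "\<dots> = (\<Sum>k\<in>K n. ennreal (H (r n k) - H (l n k)))"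
        using lr mono cont by (intro sum.cong emeasure_interval_measure_Icc refl) (auto dest: monoD)
      also have "\<dots> = ennreal (\<Sum>k\<in>K n. \<bar>H (r n k) - H (l n k)\<bar>)"
        using lr monoD[OF mono] by (subst sum_ennreal) auto
      also have "\<dots> \<le> ennreal \<epsilon>"
        using \<delta>(2)[OF finK _ dj len] lr by (intro ennreal_leI) (simp add: less_imp_le)
      finally show ?thesis .
    qed
    have W_borel: "W n \<in> sets borel" for n
      unfolding W_def using finK by (intro sets.finite_UN) auto
    \<comment> \<open>The unions of cells need not be nested, but the intersections of their tails increase.\<close>
    define T where "T m = (\<Inter>n\<in>{m..}. W n)" for m
    have T_borel: "T m \<in> sets borel" for m
      unfolding T_def using W_borel by (intro sets.countable_INT'') auto
    have "U \<subseteq> (\<Union>m. T m)"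
    proof
      fix x assume "x \<in> U"
      from dyadic_cells_exhaust_open[OF U(1) this] obtain m where
        "\<forall>n\<ge>m. \<exists>k::int. \<bar>k\<bar> \<le> int n * 2^n \<and> {l n k..r n k} \<subseteq> U \<and> x \<in> {l n k..r n k}"
        by (auto simp: eventually_sequentially l_def r_def)
      then have "\<forall>n\<ge>m. x \<in> W n" unfolding W_def K_def by blast
      then show "x \<in> (\<Union>m. T m)" unfolding T_def by auto
    qed
    then have "emeasure ?M U \<le> emeasure ?M (\<Union>m. T m)"
      using T_borel by (intro emeasure_mono) auto
    also have "\<dots> = (SUP m. emeasure ?M (T m))"
    proof (rule SUP_emeasure_incseq[symmetric])
      show "range T \<subseteq> sets ?M" using T_borel by auto
      show "incseq T" unfolding T_def incseq_def by (auto intro: INT_anti_mono)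
    qed
    also have "\<dots> \<le> ennreal \<epsilon>"
    proof (rule SUP_least)
      fix m
      have "emeasure ?M (T m) \<le> emeasure ?M (W m)"
        using W_borel by (intro emeasure_mono) (auto simp: T_def)
      also note small
      finally show "emeasure ?M (T m) \<le> ennreal \<epsilon>" .
    qed
    finally show ?thesis .
  qed
  then show ?thesis using \<delta>(1) by blast
qed

text \<open>By outer regularity a null set lies in open sets of arbitrarily small length.\<close>

lemma mono_abs_cont_measure_absolutely_continuous:
  assumes mono: "mono H" and ac: "abs_cont H"
  shows "absolutely_continuous lborel (interval_measure H)"
  unfolding absolutely_continuous_def
proof
  fix N :: "real set" assume N: "N \<in> null_sets lborel"
  have "emeasure (interval_measure H) N \<le> 0"
  proof (rule ennreal_le_epsilon)
    fix \<epsilon> :: real assume "\<epsilon> > 0"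
    then obtain \<delta> where \<delta>: "\<delta> > 0"
      "\<And>U. open U \<Longrightarrow> emeasure lborel U < ennreal \<delta> \<Longrightarrow> emeasure (interval_measure H) U \<le> ennreal \<epsilon>"
      using mono_abs_cont_small_on_open[OF mono ac] by blast
    obtain U where U: "open U" "N \<subseteq> U" "emeasure lborel (U - N) < ennreal \<delta>"
      using outer_regular_lborel[of N \<delta>] N \<delta>(1) by (auto simp: null_sets_def)
    have "emeasure lborel U = emeasure lborel (U - N)"
      using N U(1) by (intro emeasure_Diff_null_set[symmetric]) auto
    then have "emeasure (interval_measure H) U \<le> ennreal \<epsilon>" using \<delta>(2) U by simp
    moreover have "emeasure (interval_measure H) N \<le> emeasure (interval_measure H) U"
      using U by (intro emeasure_mono) auto
    ultimately show "emeasure (interval_measure H) N \<le> 0 + ennreal \<epsilon>" by simp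
  qed
  then show "N \<in> null_sets (interval_measure H)"
    using N by (auto simp: null_sets_def)
qed

lemma mono_abs_cont_density:
  assumes mono: "mono H" and ac: "abs_cont H"
  obtains g where "g \<in> borel_measurable borel"
    and "\<And>x y. x \<le> y \<Longrightarrow> set_integrable lborel {x..y} g"
    and "\<And>x y. x \<le> y \<Longrightarrow> (LINT t:{x..y}|lborel. g t) = H y - H x"
proof -
  let ?M = "interval_measure H"
  have cont: "continuous_on UNIV H" by (rule abs_cont_imp_continuous[OF ac])
  obtain G where G[measurable]: "G \<in> borel_measurable lborel" and dens: "density lborel G = ?M"
    using sigma_finite_measure.Radon_Nikodym[OF sigma_finite_lborel mono_abs_cont_measure_absolutely_continuous[OF mono ac]] by auto
  have "sigma_finite_measure (density lborel G)"
    unfolding dens using mono cont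
    by (intro sigma_finite_interval_measure)
       (auto dest: monoD simp: continuous_on_eq_continuous_at continuous_at_imp_continuous_within)
  \<comment> \<open>A Radon-Nikodym density may be infinite on a null set.\<close>
  then have fin: "AE x in lborel. G x \<noteq> \<infinity>"
    using sigma_finite_measure.sigma_finite_iff_density_finite[OF sigma_finite_lborel G] by simp
  define g where "g x = enn2real (G x)" for x
  have g[measurable]: "g \<in> borel_measurable borel"
    unfolding g_def using borel_measurable_enn2real[OF G] by simp
  have *: "has_bochner_integral lborel (\<lambda>t. indicator {x..y} t *\<^sub>R g t) (H y - H x)" if xy: "x \<le> y" for x y
  proof (rule has_bochner_integral_nn_integral)
    have "(\<integral>\<^sup>+ t. ennreal (indicator {x..y} t *\<^sub>R g t) \<partial>lborel) = (\<integral>\<^sup>+ t. G t * indicator {x..y} t \<partial>lborel)"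
      using fin by (intro nn_integral_cong_AE, eventually_elim) 
         (auto simp: g_def indicator_def top.not_eq_extremum)
    also have "\<dots> = emeasure ?M {x..y}"
      unfolding dens[symmetric] by (simp add: emeasure_density)
    also have "\<dots> = ennreal (H y - H x)"
      using xy mono cont by (intro emeasure_interval_measure_Icc) (auto dest: monoD)
    finally show "(\<integral>\<^sup>+ t. ennreal (indicator {x..y} t *\<^sub>R g t) \<partial>lborel) = ennreal (H y - H x)" .
  qed (use monoD[OF mono xy] in \<open>auto simp: g_def\<close>)
  show thesis
  proof (rule that[OF g])
    show "set_integrable lborel {x..y} g" if "x \<le> y" for x y
      using *[OF that] unfolding set_integrable_def by (auto simp: has_bochner_integral_iff)
    show "(LINT t:{x..y}|lborel. g t) = H y - H x" if "x \<le> y" for x y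
      using *[OF that] unfolding set_lebesgue_integral_def by (auto simp: has_bochner_integral_iff)
  qed
qed

text \<open>Lebesgue's differentiation theorem in the one-sided form \<open>integrable_ccontinuous_explicit\<close> gives
the right derivative; applied to the reflected function it gives the left one.\<close>

lemma indefinite_integral_has_derivative_AE:
  fixes g :: "real \<Rightarrow> real"
  assumes int: "\<And>x y. x \<le> y \<Longrightarrow> set_integrable lborel {x..y} g"
    and eq: "\<And>x y. x \<le> y \<Longrightarrow> (LINT t:{x..y}|lborel. g t) = \<Phi> y - \<Phi> x"
  shows "AE x in lborel. (\<Phi> has_real_derivative g x) (at x)"
proof -
  have hk: "g integrable_on {x..y}" "x \<le> y \<Longrightarrow> integral {x..y} g = \<Phi> y - \<Phi> x" for x y
  proof -
    show "g integrable_on {x..y}"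
    proof (cases "x \<le> y")
      case True
      then show ?thesis using set_borel_integral_eq_integral(1)[OF int] by blast
    next
      case False
      then show ?thesis by (simp add: integrable_on_empty)
    qed
    show "integral {x..y} g = \<Phi> y - \<Phi> x" if "x \<le> y"
      using set_borel_integral_eq_integral(2)[OF int[OF that]] eq[OF that] by simp
  qed
  have hk': "(\<lambda>t. g (- t)) integrable_on {x..y}" 
    "x \<le> y \<Longrightarrow> integral {x..y} (\<lambda>t. g (- t)) = \<Phi> (-x) - \<Phi> (-y)" for x y
    using hk[of "-y" "-x"] Henstock_Kurzweil_Integration.integrable_reflect_real[where f=g and a="-y" and b="-x"] Henstock_Kurzweil_Integration.integral_reflect_real[where f=g and a="-y" and b="-x"]
    by auto
  obtain N1 where N1: "negligible N1" "\<And>x e. \<lbrakk>x \<notin> N1; 0 < e\<rbrakk> \<Longrightarrow>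
      \<exists>d>0. \<forall>h. 0 < h \<and> h < d \<longrightarrow> norm(integral (cbox x (x + h *\<^sub>R One)) g /\<^sub>R h ^ DIM(real) - g x) < e"
    using integrable_ccontinuous_explicit[of g] hk(1) by auto
  obtain N2 where N2: "negligible N2" "\<And>x e. \<lbrakk>x \<notin> N2; 0 < e\<rbrakk> \<Longrightarrow>
      \<exists>d>0. \<forall>h. 0 < h \<and> h < d \<longrightarrow> norm(integral (cbox x (x + h *\<^sub>R One)) (\<lambda>t. g (- t)) /\<^sub>R h ^ DIM(real) - g (- x)) < e"
    using integrable_ccontinuous_explicit[of "\<lambda>t. g (- t)"] hk'(1) by auto
  have "negligible (uminus ` N2)"
    using N2(1) by (intro negligible_differentiable_image_negligible)
      (auto intro!: derivative_intros simp: differentiable_on_def)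
  then have "negligible (N1 \<union> uminus ` N2)" using N1(1) by (rule negligible_Un[rotated])
  then have "AE x in lebesgue. x \<notin> N1 \<union> uminus ` N2"
    by (intro AE_not_in) (simp only: negligible_iff_null_sets)
  then have "AE x in lborel. x \<notin> N1 \<union> uminus ` N2"
    by (simp only: AE_completion_iff)
  then show ?thesis
  proof eventually_elim
    case (elim x)
    then have x: "x \<notin> N1" "- x \<notin> N2" by force+
    have "\<exists>d>0. \<forall>h. h \<noteq> 0 \<and> \<bar>h\<bar> < d \<longrightarrow> \<bar>(\<Phi> (x + h) - \<Phi> x) / h - g x\<bar> < e" if e: "e > 0" for e
    proof -
      obtain d1 where d1: "d1 > 0" "\<And>h. 0 < h \<Longrightarrow> h < d1 \<Longrightarrow> \<bar>(\<Phi> (x + h) - \<Phi> x) / h - g x\<bar> < e"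
        using N1(2)[OF x(1) e] hk(2)[of x] by (auto simp: divide_inverse mult.commute)
      obtain d2 where d2: "d2 > 0" "\<And>h. 0 < h \<Longrightarrow> h < d2 \<Longrightarrow> \<bar>(\<Phi> x - \<Phi> (x - h)) / h - g x\<bar> < e"
        using N2(2)[OF x(2) e] hk'(2)[of "-x"] by (auto simp: divide_inverse mult.commute)
      have "\<bar>(\<Phi> (x + h) - \<Phi> x) / h - g x\<bar> < e" if "h \<noteq> 0" "\<bar>h\<bar> < min d1 d2" for h
      proof (cases "h > 0")
        case True
        then show ?thesis using d1(2) that by simp
      next
        case False
        then have "\<bar>(\<Phi> x - \<Phi> (x - (- h))) / (- h) - g x\<bar> < e" using that by (intro d2(2)) auto
        moreover have "(\<Phi> x - \<Phi> (x - (- h))) / (- h) = (\<Phi> (x + h) - \<Phi> x) / h"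
          by (simp add: minus_divide_right[symmetric] minus_divide_left diff_divide_distrib)
        ultimately show ?thesis by simp
      qed
      then show ?thesis using d1(1) d2(1) by (intro exI[of _ "min d1 d2"]) auto
    qed
    then show ?case unfolding DERIV_def LIM_eq by auto
  qed
qed

text \<open>With a monotone majorant \<open>V\<close>, both \<open>V + f\<close> and \<open>V - f\<close> are monotone, and \<open>f\<close> is half their
difference.\<close>

lemma abs_cont_FTC:
  assumes f: "abs_cont f" and const: "\<forall>x\<le>a. f x = f a"
  obtains g where "g \<in> borel_measurable borel"
    and "\<And>x y. x \<le> y \<Longrightarrow> set_integrable lborel {x..y} g"
    and "\<And>x y. x \<le> y \<Longrightarrow> (LINT t:{x..y}|lborel. g t) = f y - f x"
    and "AE x in lborel. (f has_real_derivative g x) (at x)"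
proof -
  obtain V where V: "mono V" "abs_cont V" "\<And>x y. x \<le> y \<Longrightarrow> \<bar>f y - f x\<bar> \<le> V y - V x"
    using abs_cont_monotone_majorant[OF f] const by blast
  have mono: "mono (\<lambda>x. V x + f x)" "mono (\<lambda>x. V x - f x)"
    using V(3) by (auto intro!: monoI simp: abs_le_iff) (smt (verit))+
  obtain g1 where g1: "g1 \<in> borel_measurable borel" "\<And>x y. x \<le> y \<Longrightarrow> set_integrable lborel {x..y} g1"
    "\<And>x y. x \<le> y \<Longrightarrow> (LINT t:{x..y}|lborel. g1 t) = (V y + f y) - (V x + f x)"
    using mono_abs_cont_density[OF mono(1) abs_cont_add[OF V(2) f]] by blast
  obtain g2 where g2: "g2 \<in> borel_measurable borel" "\<And>x y. x \<le> y \<Longrightarrow> set_integrable lborel {x..y} g2"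
    "\<And>x y. x \<le> y \<Longrightarrow> (LINT t:{x..y}|lborel. g2 t) = (V y - f y) - (V x - f x)"
    using mono_abs_cont_density[OF mono(2) abs_cont_diff[OF V(2) f]] by blast
  define g where "g x = (g1 x - g2 x) / 2" for x
  have g: "g \<in> borel_measurable borel"
    unfolding g_def using borel_measurable_diff[OF g1(1) g2(1)] by (intro borel_measurable_divide) auto
  have int: "set_integrable lborel {x..y} g" if "x \<le> y" for x y
    unfolding g_def using g1(2)[OF that] g2(2)[OF that] by (intro set_integrable_divide set_integral_diff) auto
  have val: "(LINT t:{x..y}|lborel. g t) = f y - f x" if "x \<le> y" for x y
    unfolding g_def using g1(2,3)[OF that] g2(2,3)[OF that] by (simp add: set_integral_diff)
  show thesis
    by (rule that[OF g int val indefinite_integral_has_derivative_AE[OF int val]])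
qed

text \<open>Split the density at a height \<open>n\<close>: the part above \<open>n\<close> has small integral over the whole line, the
part below contributes at most \<open>n\<close> times the length.\<close>

lemma abs_cont_indefinite_integral:
  fixes g :: "real \<Rightarrow> real"
  assumes g: "integrable lborel g" and nonneg: "\<And>x. 0 \<le> g x"
    and eq: "\<And>x y. x \<le> y \<Longrightarrow> \<Phi> y - \<Phi> x = (LINT t:{x<..<y}|lborel. g t)"
  shows "abs_cont \<Phi>"
proof (rule abs_contI)
  fix \<epsilon> :: real assume \<epsilon>: "\<epsilon> > 0"
  have gm[measurable]: "g \<in> borel_measurable lborel" using g by simp
  have "(\<lambda>n. \<integral>t. max 0 (g t - real n) \<partial>lborel) \<longlonglongrightarrow> (\<integral>t. 0 \<partial>(lborel :: real measure))"
  proof (rule integral_dominated_convergence[where w=g])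
    show "AE t in lborel. (\<lambda>n. max 0 (g t - real n)) \<longlonglongrightarrow> 0"
    proof (rule AE_I2)
      fix t
      obtain m :: nat where m: "g t \<le> real m" using real_arch_simple by blast
      show "(\<lambda>n. max 0 (g t - real n)) \<longlonglongrightarrow> 0"
        using m by (intro tendsto_eventually eventually_sequentiallyI[of m]) auto
    qed
  qed (use g nonneg in auto)
  then have "\<forall>\<^sub>F n in sequentially. (\<integral>t. max 0 (g t - real n) \<partial>lborel) < \<epsilon> / 2"
    using \<epsilon> by (intro order_tendstoD(2)[where a = "\<epsilon>/2"]) auto
  then obtain n where n: "(\<integral>t. max 0 (g t - real n) \<partial>lborel) < \<epsilon> / 2"
    by (auto simp: eventually_sequentially)
  define \<delta> where "\<delta> = \<epsilon> / (2 * (real n + 1))"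
  have "\<delta> > 0" using \<epsilon> by (simp add: \<delta>_def)
  have tr_int: "integrable lborel (\<lambda>t. max 0 (g t - real n))"
    by (rule Bochner_Integration.integrable_bound[OF g]) (use nonneg in auto)
  have "(\<Sum>i\<in>I. \<bar>\<Phi> (v i) - \<Phi> (u i)\<bar>) < \<epsilon>"
    if I: "finite I" "\<forall>i\<in>I. u i \<le> v i" "disjoint_family_on (\<lambda>i. {u i<..<v i}) I"
        "(\<Sum>i\<in>I. v i - u i) < \<delta>" for I :: "int set" and u v
  proof -
    let ?ind = "\<lambda>i. indicator {u i<..<v i} :: real \<Rightarrow> real"
    have int1: "integrable lborel (\<lambda>t. ?ind i t * g t)" for i
      using g by (intro integrable_real_mult_indicator[where f=g, simplified mult.commute[of "g _"]]) auto
    have int2: "integrable lborel (?ind i)" for i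
      by (intro integrable_real_indicator emeasure_bounded_finite) auto
    have "(\<Sum>i\<in>I. \<bar>\<Phi> (v i) - \<Phi> (u i)\<bar>) = (\<Sum>i\<in>I. \<integral>t. ?ind i t * g t \<partial>lborel)"
    proof (rule sum.cong[OF refl])
      fix i assume "i \<in> I"
      then have "\<Phi> (v i) - \<Phi> (u i) = (\<integral>t. ?ind i t * g t \<partial>lborel)"
        using eq[of "u i" "v i"] I(2) by (simp add: set_lebesgue_integral_def)
      moreover have "0 \<le> (\<integral>t. ?ind i t * g t \<partial>lborel)" using nonneg by (intro integral_nonneg_AE) auto
      ultimately show "\<bar>\<Phi> (v i) - \<Phi> (u i)\<bar> = (\<integral>t. ?ind i t * g t \<partial>lborel)" by simp
    qed
    also have "\<dots> = (\<integral>t. (\<Sum>i\<in>I. ?ind i t * g t) \<partial>lborel)"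
      using int1 by (intro Bochner_Integration.integral_sum[symmetric]) auto
    also have "\<dots> \<le> (\<integral>t. (\<Sum>i\<in>I. real n * ?ind i t) + max 0 (g t - real n) \<partial>lborel)"
    proof (rule integral_mono)
      fix t
      have s: "(\<Sum>i\<in>I. ?ind i t) = indicator (\<Union>i\<in>I. {u i<..<v i}) t"
        using I(1,3) by (simp add: indicator_UN_disjoint)
      have "(\<Sum>i\<in>I. ?ind i t) * g t \<le> real n * (\<Sum>i\<in>I. ?ind i t) + max 0 (g t - real n)"
        unfolding s by (auto simp: indicator_def)
      then show "(\<Sum>i\<in>I. ?ind i t * g t) \<le> (\<Sum>i\<in>I. real n * ?ind i t) + max 0 (g t - real n)"
        by (simp add: sum_distrib_left sum_distrib_right)
    qed (use int1 int2 tr_int in auto)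
    also have "\<dots> = real n * (\<Sum>i\<in>I. v i - u i) + (\<integral>t. max 0 (g t - real n) \<partial>lborel)"
    proof -
      have "(\<integral>t. (\<Sum>i\<in>I. real n * ?ind i t) \<partial>lborel) = (\<Sum>i\<in>I. real n * (v i - u i))"
        using I(2) int2 by (subst Bochner_Integration.integral_sum) auto
      then show ?thesis using int2 tr_int
        by (subst Bochner_Integration.integral_add) (auto simp: sum_distrib_left)
    qed
    also have "\<dots> \<le> (real n + 1) * \<delta> + (\<integral>t. max 0 (g t - real n) \<partial>lborel)"
      using I(2,4) by (intro add_right_mono mult_mono) (auto intro!: sum_nonneg)
    also have "\<dots> < (real n + 1) * \<delta> + \<epsilon> / 2" using n by simp
    also have "\<dots> = \<epsilon>" unfolding \<delta>_def by (simp add: field_simps)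
    finally show ?thesis .
  qed
  then show "\<exists>\<delta>>0. \<forall>(I::int set) u v. finite I \<longrightarrow> (\<forall>i\<in>I. u i \<le> v i) \<longrightarrow>
        disjoint_family_on (\<lambda>i. {u i<..<v i}) I \<longrightarrow> (\<Sum>i\<in>I. v i - u i) < \<delta> \<longrightarrow>
        (\<Sum>i\<in>I. \<bar>\<Phi> (v i) - \<Phi> (u i)\<bar>) < \<epsilon>"
    using \<open>\<delta> > 0\<close> by blast
qed

section \<open>The reference measure and its isoperimetric profile\<close>

text \<open>Describes the quantiles of the reference measure: a tail of mass \<open>t \<le> 1/2\<close> starts at distance
\<open>tail_depth t\<close> from the median. The maximum makes the value 0 for \<open>t \<ge> 1/2\<close>, so that both halves
of the line are covered by one formula.\<close>

definition tail_depth :: "real \<Rightarrow> real" where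
  "tail_depth t = sqrt (max 1 (1 - ln (2 * t))) - 1"

definition quantile :: "real \<Rightarrow> real" where
  "quantile u = tail_depth (1 - u) - tail_depth u"

text \<open>The isoperimetric profile of the reference measure: its density at the quantile of order \<open>u\<close>.\<close>

definition profile :: "real \<Rightarrow> real" where
  "profile u = 2 * min u (1 - u) * (tail_depth (min u (1 - u)) + 1)"

definition potential :: "real \<Rightarrow> real" where
  "potential y = y\<^sup>2 + 2 * \<bar>y\<bar> - ln (1 + \<bar>y\<bar>)"

text \<open>The derivative of the potential; at its kink 0, where \<open>sgn 0 = 0\<close>, the value 0 is a subgradient.\<close>

definition potential_slope :: "real \<Rightarrow> real" where
  "potential_slope y = 2 * y + sgn y * (2 - 1 / (1 + \<bar>y\<bar>))"

lemma tail_depth_nonneg: "0 \<le> tail_depth t"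
  unfolding tail_depth_def by simp

lemma tail_depth_eq_0: "1/2 \<le> t \<Longrightarrow> tail_depth t = 0"
  unfolding tail_depth_def by simp

lemma tail_depth_le_half:
  assumes "0 < t" "t \<le> 1/2"
  shows "tail_depth t = sqrt (1 - ln (2 * t)) - 1"
  using assms unfolding tail_depth_def by (simp add: max_def)

lemma sqrt_max_one_Lipschitz: "\<bar>sqrt (max 1 x) - sqrt (max 1 y)\<bar> \<le> \<bar>x - y\<bar>"
proof -
  let ?a = "sqrt (max 1 x)" and ?b = "sqrt (max 1 y)"
  have ab: "?a \<ge> 1" "?b \<ge> 1" by auto
  then have "1 \<le> ?a + ?b" by linarith
  then have "\<bar>?a - ?b\<bar> * 1 \<le> \<bar>?a - ?b\<bar> * (?a + ?b)"
    by (rule mult_left_mono) simp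
  also have "\<dots> = \<bar>(?a - ?b) * (?a + ?b)\<bar>" using ab by (simp add: abs_mult)
  also have "(?a - ?b) * (?a + ?b) = max 1 x - max 1 y"
    by (simp add: algebra_simps flip: power2_eq_square)
  also have "\<bar>max 1 x - max 1 y\<bar> \<le> \<bar>x - y\<bar>" by auto
  finally show ?thesis by simp
qed

text \<open>Since only the ratio of the arguments enters, measures with comparable tails have quantiles at
bounded distance.\<close>

lemma tail_depth_log_Lipschitz:
  assumes "0 < s" "0 < t"
  shows "\<bar>tail_depth t - tail_depth s\<bar> \<le> \<bar>ln (t / s)\<bar>"
proof -
  have "\<bar>tail_depth t - tail_depth s\<bar> \<le> \<bar>ln (2 * s) - ln (2 * t)\<bar>"
    using sqrt_max_one_Lipschitz[of "1 - ln (2 * t)" "1 - ln (2 * s)"] unfolding tail_depth_def by simp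
  also have "\<dots> = \<bar>ln (t / s)\<bar>" using assms by (simp add: ln_mult ln_div)
  finally show ?thesis .
qed

lemma tail_depth_Lipschitz:
  assumes "0 < \<alpha>" "\<alpha> \<le> s" "\<alpha> \<le> t"
  shows "\<bar>tail_depth t - tail_depth s\<bar> \<le> (1 / \<alpha>) * \<bar>t - s\<bar>"
proof -
  have *: "ln (t / s) \<le> (1 / \<alpha>) * \<bar>t - s\<bar>" if "\<alpha> \<le> s" "\<alpha> \<le> t" for s t
  proof -
    have "ln (t / s) \<le> t / s - 1" using that assms(1) by (intro ln_le_minus_one) simp
    also have "\<dots> = (t - s) / s" using that assms(1) by (simp add: diff_divide_distrib)
    also have "\<dots> \<le> \<bar>t - s\<bar> / \<alpha>" using that assms(1) by (intro frac_le) auto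
    finally show ?thesis by simp
  qed
  have "\<bar>ln (t / s)\<bar> \<le> (1 / \<alpha>) * \<bar>t - s\<bar>"
    using *[OF assms(2,3)] *[OF assms(3,2)] assms by (simp add: abs_le_iff ln_div abs_minus_commute)
  then show ?thesis using tail_depth_log_Lipschitz[of s t] assms by linarith
qed

lemma tail_depth_antimono:
  assumes "0 < s" "s \<le> t"
  shows "tail_depth t \<le> tail_depth s"
proof -
  have "ln (2 * s) \<le> ln (2 * t)" using assms by simp
  then have "max 1 (1 - ln (2 * t)) \<le> max 1 (1 - ln (2 * s))" by (intro max.mono) auto
  then show ?thesis unfolding tail_depth_def by simp
qed

text \<open>The quadratic part of the potential accounts exactly for the term \<open>(T - y)\<^sup>2\<close>; the rest lies above
its tangents by concavity of the logarithm.\<close>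

lemma potential_tangent:
  "potential y + potential_slope y * (T - y) + (T - y)\<^sup>2 \<le> potential T"
proof -
  let ?c = "2 - 1 / (1 + \<bar>y\<bar>)"
  have pos: "1 + \<bar>y\<bar> > 0" "1 + \<bar>T\<bar> > 0" by auto
  have c: "?c \<ge> 0" using pos by (simp add: field_simps)
  have "ln ((1 + \<bar>T\<bar>) / (1 + \<bar>y\<bar>)) \<le> (1 + \<bar>T\<bar>) / (1 + \<bar>y\<bar>) - 1"
    using pos by (intro ln_le_minus_one) simp
  also have "\<dots> = (\<bar>T\<bar> - \<bar>y\<bar>) / (1 + \<bar>y\<bar>)" using pos by (simp add: field_simps)
  finally have ln: "ln (1 + \<bar>T\<bar>) \<le> ln (1 + \<bar>y\<bar>) + (\<bar>T\<bar> - \<bar>y\<bar>) / (1 + \<bar>y\<bar>)"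
    using pos by (simp add: ln_div)
  have "sgn y * (T - y) \<le> \<bar>T\<bar> - \<bar>y\<bar>" by (auto simp: sgn_if)
  then have "?c * (sgn y * (T - y)) \<le> ?c * (\<bar>T\<bar> - \<bar>y\<bar>)" using c by (rule mult_left_mono)
  also have "\<dots> = 2 * (\<bar>T\<bar> - \<bar>y\<bar>) - (\<bar>T\<bar> - \<bar>y\<bar>) / (1 + \<bar>y\<bar>)" by (simp add: algebra_simps)
  finally have "sgn y * ?c * (T - y) \<le> 2 * (\<bar>T\<bar> - \<bar>y\<bar>) - (ln (1 + \<bar>T\<bar>) - ln (1 + \<bar>y\<bar>))"
    using ln by (simp add: mult.commute mult.left_commute)
  then show ?thesis
    unfolding potential_def potential_slope_def
    by (simp add: power2_eq_square algebra_simps)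
qed

lemma quantile_sym: "quantile (1 - u) = - quantile u"
  unfolding quantile_def by simp

lemma profile_sym: "profile (1 - u) = profile u"
  unfolding profile_def by (simp add: min.commute)

lemma potential_sym: "potential (- y) = potential y" "potential_slope (- y) = - potential_slope y"
  unfolding potential_def potential_slope_def by (simp_all add: sgn_minus)

lemma quantile_le_half:
  assumes "0 < u" "u \<le> 1/2"
  shows "quantile u = 1 - sqrt (1 - ln (2 * u))"
  using assms tail_depth_le_half[OF assms] tail_depth_eq_0[of "1 - u"] unfolding quantile_def by simp

lemma profile_le_half:
  assumes "0 < u" "u \<le> 1/2"
  shows "profile u = 2 * u * sqrt (1 - ln (2 * u))"
  using assms tail_depth_le_half[OF assms] unfolding profile_def by (simp add: min_def)

text \<open>All functions attached to the reference measure are odd or even under \<open>u \<mapsto> 1 - u\<close>, so computations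
are done for the lower half.\<close>

lemma symmetric_half_cases:
  assumes "0 < u" "u < 1"
    and "\<And>u. 0 < u \<Longrightarrow> u \<le> 1/2 \<Longrightarrow> P u" "\<And>u. P (1 - u) \<Longrightarrow> P u"
  shows "P (u::real)"
proof (cases "u \<le> 1/2")
  case False
  then have "P (1 - u)" using assms(2) by (intro assms(3)) auto
  then show ?thesis by (rule assms(4))
qed (use assms in auto)

lemma profile_pos:
  assumes "0 < u" "u < 1"
  shows "0 < profile u"
  using assms tail_depth_nonneg[of "min u (1 - u)"] unfolding profile_def by simp

text \<open>With \<open>s = sqrt (1 - ln (2 * u))\<close>, the quantile is \<open>1 - s\<close> and the potential there is
\<open>s\<^sup>2 - 1 - ln s = - ln (2 * u * s)\<close>.\<close>

lemma ln_profile: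
  assumes "0 < u" "u < 1"
  shows "ln (profile u) = - potential (quantile u)"
  using assms
proof (rule symmetric_half_cases)
  fix u :: real assume u: "0 < u" "u \<le> 1/2"
  define s where "s = sqrt (1 - ln (2 * u))"
  have L: "ln (2 * u) \<le> 0" using u by simp
  then have s: "s \<ge> 1" "s\<^sup>2 = 1 - ln (2 * u)" unfolding s_def by auto
  have "potential (quantile u) = s\<^sup>2 - 1 - ln s"
    unfolding quantile_le_half[OF u] potential_def s_def[symmetric]
    using s by (simp add: power2_eq_square algebra_simps)
  then show "ln (profile u) = - potential (quantile u)"
    unfolding profile_le_half[OF u] s_def[symmetric] using s u by (simp add: ln_mult)
qed (simp add: profile_sym quantile_sym potential_sym)

text \<open>Used only to see that the boundary terms vanish, so the logarithm is estimated crudely by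
\<open>1 - ln y \<le> 1 / y\<close>.\<close>

lemma profile_bound:
  assumes "0 < u" "u < 1"
  shows "profile u \<le> sqrt (2 * min u (1 - u))"
  using assms
proof (rule symmetric_half_cases)
  fix u :: real assume u: "0 < u" "u \<le> 1/2"
  have "ln (1 / (2*u)) \<le> 1 / (2*u) - 1" using u by (intro ln_le_minus_one) simp
  then have "1 - ln (2 * u) \<le> 1 / (2 * u)" using u by (simp add: ln_div)
  then have "sqrt (1 - ln (2 * u)) \<le> sqrt (1 / (2 * u))" by simp
  then have "profile u \<le> 2 * u * sqrt (1 / (2 * u))"
    unfolding profile_le_half[OF u] using u by (intro mult_left_mono) auto
  also have "\<dots> = sqrt (2 * u)"
    using u by (simp add: real_sqrt_divide field_simps)
  finally show "profile u \<le> sqrt (2 * min u (1 - u))" using u by (simp add: min_def)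
qed (simp add: profile_sym min.commute)

lemma profile_square:
  assumes "0 < u" "u < 1"
  shows "(profile u)\<^sup>2 = 4 * (min u (1 - u))\<^sup>2 * (ln (1 / (2 * min u (1 - u))) + 1)"
  using assms
proof (rule symmetric_half_cases)
  fix u :: real assume u: "0 < u" "u \<le> 1/2"
  then have "ln (2 * u) \<le> 0" by simp
  then have "(sqrt (1 - ln (2 * u)))\<^sup>2 = 1 - ln (2 * u)" by simp
  moreover have "min u (1 - u) = u" using u by (simp add: min_def)
  ultimately show "(profile u)\<^sup>2 = 4 * (min u (1 - u))\<^sup>2 * (ln (1 / (2 * min u (1 - u))) + 1)"
    unfolding profile_le_half[OF u] using u by (simp add: power_mult_distrib ln_div)
qed (simp add: profile_sym min.commute)

text \<open>The median is excluded: there the profile has a kink. This costs nothing later, since a strictly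
increasing distribution function takes the value 1/2 at most once.\<close>

lemma quantile_profile_has_derivative:
  assumes "0 < u" "u < 1" "u \<noteq> 1/2"
  shows "(quantile has_real_derivative 1 / profile u) (at u)"
    and "(profile has_real_derivative - potential_slope (quantile u)) (at u)"
proof -
  have low: "(quantile has_real_derivative 1 / profile u) (at u) \<and>
      (profile has_real_derivative - potential_slope (quantile u)) (at u)"
    if u: "0 < u" "u < 1/2" for u
  proof -
    define s where "s = sqrt (1 - ln (2 * u))"
    have L: "ln (2 * u) < 0" using u by simp
    then have s: "s > 1" "s\<^sup>2 = 1 - ln (2 * u)" unfolding s_def by auto
    have ev: "\<forall>\<^sub>F v in nhds u. v \<in> {0<..<1/2}"
      using u by (intro eventually_nhds_in_open) auto
    have ds: "((\<lambda>u. sqrt (1 - ln (2 * u))) has_real_derivative - 1 / (2 * s * u)) (at u)"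
    proof -
      have "((\<lambda>u. 1 - ln (2 * u)) has_real_derivative - 1 / u) (at u)"
        using u by (auto intro!: derivative_eq_intros)
      then have "((\<lambda>u. sqrt (1 - ln (2 * u))) has_real_derivative inverse s / 2 * (- 1 / u)) (at u)"
        unfolding s_def using L by (intro DERIV_chain2[OF DERIV_real_sqrt]) auto
      moreover have "inverse s / 2 * (- 1 / u) = - 1 / (2 * s * u)"
        using s(1) u by (simp add: field_simps)
      ultimately show ?thesis by (simp only:)
    qed
    have qv: "quantile u = 1 - s" and pv: "profile u = 2 * u * s"
      using u quantile_le_half[of u] profile_le_half[of u] unfolding s_def by auto
    have "((\<lambda>u. 1 - sqrt (1 - ln (2 * u))) has_real_derivative 1 / (2 * u * s)) (at u)"
      using DERIV_diff[OF DERIV_const ds, of 1] by (simp add: mult.commute mult.left_commute)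
    moreover have "\<forall>\<^sub>F v in nhds u. quantile v = 1 - sqrt (1 - ln (2 * v))"
      using ev by eventually_elim (auto intro: quantile_le_half)
    ultimately have 1: "(quantile has_real_derivative 1 / profile u) (at u)"
      unfolding pv by (subst DERIV_cong_ev[OF refl _ refl]) auto
    have "((\<lambda>u. 2 * u * sqrt (1 - ln (2 * u))) has_real_derivative
        2 * sqrt (1 - ln (2 * u)) + - 1 / (2 * s * u) * (2 * u)) (at u)"
      by (rule DERIV_mult[OF _ ds]) (auto intro!: derivative_eq_intros)
    moreover have "2 * sqrt (1 - ln (2 * u)) + - 1 / (2 * s * u) * (2 * u) = 2 * s - 1 / s"
      using u s(1) unfolding s_def[symmetric] by simp
    ultimately have "((\<lambda>u. 2 * u * sqrt (1 - ln (2 * u))) has_real_derivative 2 * s - 1 / s) (at u)"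
      by (simp only:)
    moreover have "\<forall>\<^sub>F v in nhds u. profile v = 2 * v * sqrt (1 - ln (2 * v))"
      using ev by eventually_elim (auto intro: profile_le_half)
    moreover have "- potential_slope (quantile u) = 2 * s - 1 / s"
      unfolding qv potential_slope_def using s(1) by (simp add: sgn_if)
    ultimately have 2: "(profile has_real_derivative - potential_slope (quantile u)) (at u)"
      by (subst DERIV_cong_ev[OF refl _ refl]) auto
    show ?thesis using 1 2 by blast
  qed
  have "(quantile has_real_derivative 1 / profile u) (at u) \<and>
      (profile has_real_derivative - potential_slope (quantile u)) (at u)"
  proof (cases "u < 1/2")
    case True
    then show ?thesis using low assms by blast
  next
    case False
    then have l: "(quantile has_real_derivative 1 / profile (1 - u)) (at (1 - u))"
      "(profile has_real_derivative - potential_slope (quantile (1 - u))) (at (1 - u))"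
      using low[of "1 - u"] assms by auto
    have d: "((\<lambda>u. 1 - u) has_real_derivative - 1) (at u)" by (auto intro!: derivative_eq_intros)
    have "((\<lambda>u. - quantile (1 - u)) has_real_derivative 1 / profile u) (at u)"
      using DERIV_minus[OF DERIV_chain2[OF l(1) d]] by (simp add: profile_sym)
    moreover have "((\<lambda>u. profile (1 - u)) has_real_derivative - potential_slope (quantile u)) (at u)"
      using DERIV_chain2[OF l(2) d] by (simp add: quantile_sym potential_sym)
    ultimately show ?thesis by (simp add: quantile_sym profile_sym)
  qed
  then show "(quantile has_real_derivative 1 / profile u) (at u)"
    and "(profile has_real_derivative - potential_slope (quantile u)) (at u)" by auto
qed

text \<open>The infinitesimal form of the transport argument. Here \<open>u\<close> and \<open>G\<close> are the values of two
distribution functions at the same point and \<open>D\<close> is the ratio of their densities. Then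
\<open>D * profile u / profile G\<close> is the derivative of the monotone map \<open>y \<mapsto> y + \<theta>\<close> in the coordinate
\<open>y = quantile u\<close>, and the potentials account for the reference density at the two ends.\<close>

lemma transport_log_inequality:
  assumes u: "0 < u" "u < 1" and G: "0 < G" "G < 1" and D: "0 < D"
  defines "\<theta> \<equiv> quantile G - quantile u"
  shows "ln D \<le> D * profile u / profile G - 1 - potential_slope (quantile u) * \<theta> - \<theta>\<^sup>2"
proof -
  have pos: "profile u > 0" "profile G > 0" using profile_pos u G by auto
  have "ln (D * profile u / profile G) \<le> D * profile u / profile G - 1"
    using pos D by (intro ln_le_minus_one) simp
  moreover have "ln (D * profile u / profile G) = ln D - potential (quantile u) + potential (quantile G)"
    using pos D ln_profile u G by (simp add: ln_mult ln_div)
  moreover have "potential (quantile u) + potential_slope (quantile u) * \<theta> + \<theta>\<^sup>2 \<le> potential (quantile G)"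
    unfolding \<theta>_def by (rule potential_tangent)
  ultimately show ?thesis by linarith
qed

section \<open>Distribution functions of positive densities\<close>

text \<open>Distribution functions are handled for a general density because they occur twice: for \<open>\<mu>\<close> itself
and for the measure with density \<open>f\<^sup>2\<close> relative to \<open>\<mu>\<close>.\<close>

locale positive_density =
  fixes r :: "real \<Rightarrow> real"
  assumes r_measurable [measurable]: "r \<in> borel_measurable borel"
    and r_pos: "\<And>x. 0 < r x"
    and prob_r: "prob_space (density lborel (\<lambda>x. ennreal (r x)))"
begin

abbreviation D :: "real measure" where "D \<equiv> density lborel (\<lambda>x. ennreal (r x))"

abbreviation F :: "real \<Rightarrow> real" where "F \<equiv> cdf D"

lemma distribution: "real_distribution D"
  using prob_r by (simp add: real_distribution_def real_distribution_axioms_def)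

lemma has_bochner_integral_r: "has_bochner_integral lborel r 1"
proof (rule has_bochner_integral_nn_integral)
  have "emeasure D UNIV = 1"
    using prob_space.emeasure_space_1[OF prob_r] by simp
  then show "(\<integral>\<^sup>+ x. ennreal (r x) \<partial>lborel) = ennreal 1"
    by (simp add: emeasure_density)
qed (use r_pos in \<open>auto intro: less_imp_le\<close>)

lemma integrable_r: "integrable lborel r"
  using has_bochner_integral_r by (simp add: has_bochner_integral_iff)

lemma set_integrable_r:
  assumes "A \<in> sets borel"
  shows "set_integrable lborel A r"
  using integrable_r assms unfolding set_integrable_def real_scaleR_def
  by (intro integrable_real_mult_indicator[of A lborel r, simplified mult.commute[of "r _"]]) auto

lemma measure_eq_integral:
  assumes A: "A \<in> sets borel"
  shows "measure D A = (LINT t:A|lborel. r t)"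
proof -
  have "measure D A = (\<integral>t. indicator A t \<partial>D)" using A by simp
  also have "\<dots> = (\<integral>t. r t *\<^sub>R indicator A t \<partial>lborel)"
    using A r_pos by (intro integral_density) (auto intro: less_imp_le)
  finally show ?thesis unfolding set_lebesgue_integral_def by (simp add: mult.commute)
qed

lemma cdf_increment:
  assumes "x \<le> y"
  shows "(LINT t:{x..y}|lborel. r t) = F y - F x" and "(LINT t:{x<..<y}|lborel. r t) = F y - F x"
proof -
  interpret real_distribution D by (rule distribution)
  have Ioc: "(LINT t:{x<..y}|lborel. r t) = F y - F x"
    using assms cdf_diff_eq[of x y] measure_eq_integral[of "{x<..y}"] by (cases "x = y") auto
  have m: "set_borel_measurable lborel A r" if "A \<in> sets borel" for A
    using set_integrable_r[OF that] unfolding set_integrable_def set_borel_measurable_def by simp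
  have ae: "AE t in lborel. t \<noteq> x \<and> t \<noteq> y"
    using AE_lborel_singleton[of x] AE_lborel_singleton[of y] by eventually_elim auto
  have "(LINT t:{x..y}|lborel. r t) = (LINT t:{x<..y}|lborel. r t)"
    using ae by (intro set_integral_cong_set m) auto
  then show "(LINT t:{x..y}|lborel. r t) = F y - F x" using Ioc by simp
  have "(LINT t:{x<..<y}|lborel. r t) = (LINT t:{x<..y}|lborel. r t)"
    using ae by (intro set_integral_cong_set m) auto
  then show "(LINT t:{x<..<y}|lborel. r t) = F y - F x" using Ioc by simp
qed

lemma cdf_strict_mono: "strict_mono F"
proof (rule strict_monoI)
  fix x y :: real assume xy: "x < y"
  interpret real_distribution D by (rule distribution)
  have "measure D {x<..y} \<noteq> 0"
  proof
    assume "measure D {x<..y} = 0"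
    then have "{x<..y} \<in> null_sets D" by (auto simp: emeasure_eq_measure null_sets_def)
    then have "AE t in lborel. t \<in> {x<..y} \<longrightarrow> ennreal (r t) = 0"
      by (subst (asm) null_sets_density_iff) auto
    then have "AE t in lborel. t \<notin> {x<..y}"
      using r_pos by (auto elim!: eventually_mono simp: ennreal_eq_0_iff not_le[symmetric])
    then have "emeasure lborel {x<..y} = 0"
      by (subst (asm) AE_iff_measurable[where N="{x<..y}"]) auto
    then show False using xy by simp
  qed
  then show "F x < F y"
    using cdf_diff_eq[OF xy] measure_nonneg[of D "{x<..y}"] by linarith
qed

lemma cdf_between: "0 < F x" "F x < 1"
proof -
  interpret real_distribution D by (rule distribution)
  show "0 < F x" using cdf_nonneg[of "x - 1"] strict_monoD[OF cdf_strict_mono, of "x - 1" x] by simp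
  show "F x < 1" using cdf_bounded_prob[of "x + 1"] strict_monoD[OF cdf_strict_mono, of x "x + 1"] by simp
qed

lemma mono_cdf: "mono F"
  by (rule strict_mono_mono[OF cdf_strict_mono])

lemma one_minus_cdf: "1 - F x = measure D {x<..}"
proof -
  interpret real_distribution D by (rule distribution)
  have "measure D {x<..} = measure D (space D - {..x})" by (intro arg_cong[where f="measure D"]) auto
  also have "\<dots> = 1 - F x" unfolding cdf_def by (intro prob_compl) auto
  finally show ?thesis by simp
qed

lemma abs_cont_cdf: "abs_cont F"
  by (rule abs_cont_indefinite_integral[OF integrable_r])
     (auto intro: less_imp_le[OF r_pos] simp: cdf_increment(2))

lemma cdf_has_derivative_AE: "AE x in lborel. (F has_real_derivative r x) (at x)"
  by (rule indefinite_integral_has_derivative_AE[OF set_integrable_r cdf_increment(1)]) auto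

lemma cdf_neq_AE: "AE x in lborel. F x \<noteq> c"
proof (cases "\<exists>y. F y = c")
  case True
  then obtain y where "F y = c" by blast
  then have "F x \<noteq> c" if "x \<noteq> y" for x
    using that strict_mono_eq[OF cdf_strict_mono, of x y] by simp
  then show ?thesis using AE_lborel_singleton[of y] by (auto elim: eventually_mono)
qed auto

lemma min_cdf_tendsto_0: "(\<lambda>n. min (F (real n)) (1 - F (real n))) \<longlonglongrightarrow> 0"
    "(\<lambda>n. min (F (- real n)) (1 - F (- real n))) \<longlonglongrightarrow> 0"
proof -
  interpret real_distribution D by (rule distribution)
  have top: "(\<lambda>n. F (real n)) \<longlonglongrightarrow> 1" using cdf_lim_infty prob_space by simp
  have "(\<lambda>n. min (F (real n)) (1 - F (real n))) \<longlonglongrightarrow> min 1 (1 - 1)"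
    by (intro tendsto_intros top)
  then show "(\<lambda>n. min (F (real n)) (1 - F (real n))) \<longlonglongrightarrow> 0" by simp
  have "(\<lambda>n. min (F (- real n)) (1 - F (- real n))) \<longlonglongrightarrow> min 0 (1 - 0)"
    by (intro tendsto_intros cdf_lim_neg_infty)
  then show "(\<lambda>n. min (F (- real n)) (1 - F (- real n))) \<longlonglongrightarrow> 0" by simp
qed

end

lemma abs_cont_clamp_mono:
  assumes ab: "a \<le> b" and \<Phi>: "mono \<Phi>" "abs_cont \<Phi>"
  shows "abs_cont (\<lambda>x. \<Phi> (clamp_to a b x))"
proof (rule abs_cont_dominated[OF \<Phi>(2) \<Phi>(2), of _ 1])
  fix x y :: real assume xy: "x \<le> y"
  let ?c = "clamp_to a b"
  show "\<bar>\<Phi> (?c y) - \<Phi> (?c x)\<bar> \<le> 1 * (\<bar>\<Phi> y - \<Phi> x\<bar> + \<bar>\<Phi> y - \<Phi> x\<bar>)"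
  proof (cases "?c x = ?c y")
    case False
    then have "x \<le> ?c x" "?c x \<le> ?c y" "?c y \<le> y"
      using xy ab by (auto simp: clamp_to_def max_def min_def split: if_splits)
    then have "\<Phi> x \<le> \<Phi> (?c x)" "\<Phi> (?c x) \<le> \<Phi> (?c y)" "\<Phi> (?c y) \<le> \<Phi> y"
      by (auto intro: monoD[OF \<Phi>(1)])
    then show ?thesis by simp
  qed simp
qed

text \<open>Pointwise comparability of the densities gives comparability of both tails, hence of the quantiles.
This is what keeps \<open>\<theta>\<close> bounded up to both ends of the line.\<close>

lemma quantile_cdf_diff_le_ln_ratio:
  assumes s: "positive_density s" and r: "positive_density r"
    and c: "\<And>x. r x \<le> c * s x" "\<And>x. s x \<le> c * r x"
  shows "\<bar>quantile (cdf (density lborel r) x) - quantile (cdf (density lborel s) x)\<bar> \<le> 2 * ln c"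
proof -
  interpret S: positive_density s by fact
  interpret R: positive_density r by fact
  have meas: "measure (density lborel (\<lambda>x. ennreal (r' x))) A \<le> c * measure (density lborel (\<lambda>x. ennreal (s' x))) A"
    if "positive_density s'" "positive_density r'" "\<And>x. r' x \<le> c * s' x" "A \<in> sets borel" for s' r' A
  proof -
    have "(LINT t:A|lborel. r' t) \<le> (LINT t:A|lborel. c * s' t)"
      using that positive_density.set_integrable_r by (intro set_integral_mono) auto
    then show ?thesis using that by (simp add: positive_density.measure_eq_integral)
  qed
  have c_pos: "0 < c"
  proof -
    have "0 < c * s 0" using R.r_pos[of 0] c(1)[of 0] by linarith
    then show ?thesis using S.r_pos[of 0] by (simp add: zero_less_mult_iff)
  qed
  have log: "\<bar>tail_depth t - tail_depth u\<bar> \<le> ln c" if "0 < t" "0 < u" "t \<le> c * u" "u \<le> c * t" for t u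
  proof -
    have "ln (t / u) \<le> ln c" "ln (u / t) \<le> ln c"
      using that c_pos by (simp_all add: field_simps)
    then have "\<bar>ln (t / u)\<bar> \<le> ln c" using that by (simp add: ln_div abs_le_iff)
    then show ?thesis using tail_depth_log_Lipschitz[of u t] that by linarith
  qed
  have "\<bar>tail_depth (R.F x) - tail_depth (S.F x)\<bar> \<le> ln c"
    using meas[OF s r c(1), of "{..x}"] meas[OF r s c(2), of "{..x}"] R.cdf_between S.cdf_between
    by (intro log) (auto simp: cdf_def)
  moreover have "\<bar>tail_depth (1 - R.F x) - tail_depth (1 - S.F x)\<bar> \<le> ln c"
  proof (rule log)
    show "0 < 1 - R.F x" "0 < 1 - S.F x" using R.cdf_between S.cdf_between by simp_all
    show "1 - R.F x \<le> c * (1 - S.F x)" "1 - S.F x \<le> c * (1 - R.F x)"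
      using meas[OF s r c(1), of "{x<..}"] meas[OF r s c(2), of "{x<..}"]
      unfolding R.one_minus_cdf S.one_minus_cdf by auto
  qed
  ultimately show ?thesis unfolding quantile_def by linarith
qed

section \<open>The entropy inequality on a compact interval\<close>

text \<open>Away from 0 and 1 the profile and the quantile function are bounded and Lipschitz, the kink of the
profile included.\<close>

lemma abs_cont_profile_quantile:
  assumes u: "abs_cont u" and \<alpha>: "0 < \<alpha>" "\<And>x. \<alpha> \<le> u x" "\<And>x. u x \<le> 1 - \<alpha>"
  shows "abs_cont (\<lambda>x. profile (u x))" "abs_cont (\<lambda>x. quantile (u x))"
    and "\<bar>profile (u x)\<bar> \<le> 1" "\<bar>quantile (u x)\<bar> \<le> tail_depth \<alpha>"
proof -
  have d: "abs_cont (\<lambda>x. tail_depth (u x))" "abs_cont (\<lambda>x. tail_depth (1 - u x))"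
    using \<alpha> by (intro abs_cont_Lipschitz[OF u, of _ "1/\<alpha>"] order.trans[OF tail_depth_Lipschitz[OF \<alpha>(1)]];
      simp add: algebra_simps abs_minus_commute)+
  then show "abs_cont (\<lambda>x. quantile (u x))"
    unfolding quantile_def by (intro abs_cont_diff)
  let ?m = "\<lambda>x. min (u x) (1 - u x)"
  have m: "\<alpha> \<le> ?m x" "?m x \<le> 1/2" for x using \<alpha>(2,3)[of x] by (auto simp: min_def)
  have am: "abs_cont ?m"
    by (rule abs_cont_Lipschitz[OF u, of _ 1]) (auto simp: min_def)
  have t: "0 \<le> tail_depth (?m x)" "tail_depth (?m x) \<le> tail_depth \<alpha>" for x
    using tail_depth_nonneg tail_depth_antimono[OF \<alpha>(1) m(1)] by auto
  have "abs_cont (\<lambda>x. tail_depth (?m x) + 1)"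
    by (rule abs_cont_Lipschitz[OF am, of _ "1/\<alpha>"]) (use tail_depth_Lipschitz[OF \<alpha>(1) m(1) m(1)] in auto)
  moreover have "abs_cont (\<lambda>x. 2 * ?m x)"
    using abs_cont_add[OF am am] by (simp only: mult_2)
  moreover have bd: "\<bar>2 * ?m x\<bar> \<le> tail_depth \<alpha> + 1" "\<bar>tail_depth (?m x) + 1\<bar> \<le> tail_depth \<alpha> + 1" for x
    using m[of x] t[of x] \<alpha>(1) by auto
  ultimately show "abs_cont (\<lambda>x. profile (u x))"
    unfolding profile_def by (intro abs_cont_mult[OF _ _ bd])
  have u01: "0 < u x" "u x < 1" using \<alpha>(1) \<alpha>(2,3)[of x] by auto
  have "profile (u x) \<le> sqrt (2 * ?m x)" by (rule profile_bound[OF u01])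
  also have "\<dots> \<le> 1" using m(2)[of x] by simp
  finally show "\<bar>profile (u x)\<bar> \<le> 1" using profile_pos[OF u01] by simp
  have "0 \<le> tail_depth (u x)" "0 \<le> tail_depth (1 - u x)"
    "tail_depth (u x) \<le> tail_depth \<alpha>" "tail_depth (1 - u x) \<le> tail_depth \<alpha>"
    using tail_depth_nonneg \<alpha> by (auto intro!: tail_depth_antimono simp: le_diff_eq algebra_simps)
  then show "\<bar>quantile (u x)\<bar> \<le> tail_depth \<alpha>" unfolding quantile_def by auto
qed

text \<open>The right-hand side is the derivative of \<open>y\<^sup>2 * (I * \<theta>)\<close>, written out with the product and chain
rules for \<open>y = f x\<close>, \<open>dy = f' x\<close>, \<open>I = profile (F x)\<close> and \<open>J = profile (G x)\<close>. After the bound on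
\<open>L\<close> is inserted, the two sides differ by \<open>(y * \<theta> * p + I * dy)\<^sup>2 / p\<close>.\<close>

lemma completing_square:
  fixes p I J y dy L S \<theta> R :: real
  assumes pos: "0 < p" "0 < I" and L: "L \<le> R * I / J - 1 - S * \<theta> - \<theta>\<^sup>2"
  shows "y\<^sup>2 * p * L - I\<^sup>2 / p * dy\<^sup>2
      \<le> (2 * y * dy) * (I * \<theta>) + ((- S * p) * \<theta> + ((1 / J) * (R * p) - (1 / I) * p) * I) * y\<^sup>2"
proof -
  have "y\<^sup>2 * p * L \<le> y\<^sup>2 * p * (R * I / J - 1 - S * \<theta> - \<theta>\<^sup>2)"
    using L pos by (intro mult_left_mono) auto
  moreover have "0 \<le> (y * \<theta> * p + I * dy)\<^sup>2 / p" using pos by simp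
  moreover have "(y * \<theta> * p + I * dy)\<^sup>2 / p = y\<^sup>2 * p * \<theta>\<^sup>2 + (2 * y * dy) * (I * \<theta>) + I\<^sup>2 / p * dy\<^sup>2"
    using pos by (simp add: power2_eq_square field_simps)
  moreover have "((- S * p) * \<theta> + ((1 / J) * (R * p) - (1 / I) * p) * I) * y\<^sup>2
      = y\<^sup>2 * p * (R * I / J - 1 - S * \<theta> - \<theta>\<^sup>2) + y\<^sup>2 * p * \<theta>\<^sup>2"
    using pos by (simp add: algebra_simps)
  ultimately show ?thesis by linarith
qed

lemma profile_borel_measurable [measurable]: "profile \<in> borel_measurable borel"
proof -
  have "tail_depth \<in> borel_measurable borel"
    unfolding tail_depth_def[abs_def] by measurable
  from measurable_compose[OF _ this, of "\<lambda>u. min u (1 - u)" borel]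
  have "(\<lambda>u. tail_depth (min u (1 - u))) \<in> borel_measurable borel" by simp
  then show ?thesis unfolding profile_def[abs_def] by simp
qed

text \<open>The pointwise inequality, integrated by the fundamental theorem of calculus for \<open>h\<close>. The term
\<open>h b - h a\<close> is the price for working on a compact interval, where \<open>F\<close> and \<open>G\<close> stay away from 0
and 1.\<close>

lemma log_sobolev_on_interval:
  fixes f p :: "real \<Rightarrow> real" and Z \<epsilon> M B a b :: real
  defines "F \<equiv> cdf (density lborel (\<lambda>x. ennreal (p x)))"
    and "G \<equiv> cdf (density lborel (\<lambda>x. ennreal ((f x)\<^sup>2 * p x / Z)))"
  defines "h \<equiv> \<lambda>x. (f x)\<^sup>2 * (profile (F x) * (quantile (G x) - quantile (F x)))"
  assumes P: "positive_density p" and Q: "positive_density (\<lambda>x. (f x)\<^sup>2 * p x / Z)"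
    and f: "absolutely_continuous_real f"
    and bounds: "0 < \<epsilon>" "\<And>x. \<epsilon> \<le> f x" "\<And>x. f x \<le> M" and Z: "0 < Z" and ab: "a < b"
    and B: "(\<integral>\<^sup>+ x. ennreal ((profile (F x))\<^sup>2 / p x * (deriv f x)\<^sup>2) \<partial>lborel) \<le> ennreal B" "0 \<le> B"
    and L_int: "set_integrable lborel {a..b} (\<lambda>x. (f x)\<^sup>2 * p x * ln ((f x)\<^sup>2 / Z))"
  shows "(LINT x:{a..b}|lborel. (f x)\<^sup>2 * p x * ln ((f x)\<^sup>2 / Z)) \<le> h b - h a + B"
proof -
  interpret P: positive_density p by fact
  interpret Q: positive_density "\<lambda>x. (f x)\<^sup>2 * p x / Z" by fact
  let ?c = "clamp_to a b"
  have ab': "a \<le> b" using ab by simp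
  note c = clamp_to_props[OF ab']
  have F: "mono F" "0 < F x" "F x < 1" for x
    unfolding F_def using P.mono_cdf P.cdf_between by auto
  have G: "mono G" "0 < G x" "G x < 1" for x
    unfolding G_def using Q.mono_cdf Q.cdf_between by auto
  have f_pos: "0 < f x" for x using bounds(1) bounds(2)[of x] by simp
  \<comment> \<open>On the interval both distribution functions stay between \<open>\<alpha>\<close> and \<open>1 - \<alpha>\<close>.\<close>
  define \<alpha> where "\<alpha> = min (min (F a) (1 - F b)) (min (G a) (1 - G b))"
  have \<alpha>: "0 < \<alpha>" unfolding \<alpha>_def using F G by simp
  have Fc: "\<alpha> \<le> F (?c x)" "F (?c x) \<le> 1 - \<alpha>" for x
    using monoD[OF F(1), of a "?c x"] monoD[OF F(1), of "?c x" b] c(1)[of x] unfolding \<alpha>_def by auto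
  have Gc: "\<alpha> \<le> G (?c x)" "G (?c x) \<le> 1 - \<alpha>" for x
    using monoD[OF G(1), of a "?c x"] monoD[OF G(1), of "?c x" b] c(1)[of x] unfolding \<alpha>_def by auto
  have acF: "abs_cont (\<lambda>x. F (?c x))" unfolding F_def
    by (rule abs_cont_clamp_mono[OF ab' P.mono_cdf P.abs_cont_cdf])
  have acG: "abs_cont (\<lambda>x. G (?c x))" unfolding G_def
    by (rule abs_cont_clamp_mono[OF ab' Q.mono_cdf Q.abs_cont_cdf])
  have acf: "abs_cont (\<lambda>x. f (?c x))"
    using f ab' unfolding absolutely_continuous_real_def by (intro abs_cont_clamp) auto
  have f_abs: "\<bar>f x\<bar> \<le> M" for x using f_pos[of x] bounds(3)[of x] by simp
  have acf2: "abs_cont (\<lambda>x. (f (?c x))\<^sup>2)"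
    unfolding power2_eq_square by (rule abs_cont_mult[OF acf acf f_abs f_abs])
  note FP = abs_cont_profile_quantile[OF acF \<alpha> Fc] and GP = abs_cont_profile_quantile[OF acG \<alpha> Gc]
  define T where "T = 1 + 2 * tail_depth \<alpha>"
  have "abs_cont (\<lambda>x. profile (F (?c x)) * (quantile (G (?c x)) - quantile (F (?c x))))"
  proof (rule abs_cont_mult[OF FP(1) abs_cont_diff[OF GP(2) FP(2)], of T])
    show "\<bar>profile (F (?c x))\<bar> \<le> T" for x
      using FP(3)[of x] tail_depth_nonneg[of \<alpha>] unfolding T_def by linarith
    show "\<bar>quantile (G (?c x)) - quantile (F (?c x))\<bar> \<le> T" for x
      using FP(4)[of x] GP(4)[of x] unfolding T_def by linarith
  qed
  then have "abs_cont (\<lambda>x. (f (?c x))\<^sup>2 * (profile (F (?c x)) * (quantile (G (?c x)) - quantile (F (?c x)))))"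
  proof (rule abs_cont_mult[OF acf2, of _ "M\<^sup>2 + 2 * tail_depth \<alpha>"])
    show "\<bar>(f (?c x))\<^sup>2\<bar> \<le> M\<^sup>2 + 2 * tail_depth \<alpha>" for x
    proof -
      have "(f (?c x))\<^sup>2 \<le> M\<^sup>2" using f_pos bounds(3) by (intro power_mono) (auto intro: less_imp_le)
      then show ?thesis using tail_depth_nonneg[of \<alpha>] by simp
    qed
    show "\<bar>profile (F (?c x)) * (quantile (G (?c x)) - quantile (F (?c x)))\<bar> \<le> M\<^sup>2 + 2 * tail_depth \<alpha>" for x
    proof -
      have "\<bar>quantile (G (?c x)) - quantile (F (?c x))\<bar> \<le> 2 * tail_depth \<alpha>"
        using FP(4)[of x] GP(4)[of x] by linarith
      then have "\<bar>profile (F (?c x)) * (quantile (G (?c x)) - quantile (F (?c x)))\<bar> \<le> 1 * (2 * tail_depth \<alpha>)"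
        unfolding abs_mult using FP(3)[of x] by (intro mult_mono) auto
      then show ?thesis using zero_le_power2[of M] by linarith
    qed
  qed
  then have ach: "abs_cont (\<lambda>x. h (?c x))" unfolding h_def .
  have c_const: "\<forall>x\<le>a. \<phi> (?c x) = \<phi> (?c a)" for \<phi> :: "real \<Rightarrow> real"
    using c(5) by (metis order_refl)
  have c_ends: "?c a = a" "?c b = b" using c(4) ab' by auto
  obtain g where g0: "\<And>x y. x \<le> y \<Longrightarrow> set_integrable lborel {x..y} g"
    "\<And>x y. x \<le> y \<Longrightarrow> (LINT t:{x..y}|lborel. g t) = h (?c y) - h (?c x)"
    and g3: "AE x in lborel. ((\<lambda>x. h (?c x)) has_real_derivative g x) (at x)"
    using abs_cont_FTC[OF ach c_const] by metis
  have g: "set_integrable lborel {a..b} g" "(LINT x:{a..b}|lborel. g x) = h b - h a"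
    using g0[OF ab'] unfolding c_ends by blast+
  obtain f' where f': "f' \<in> borel_measurable borel"
    "AE x in lborel. ((\<lambda>x. f (?c x)) has_real_derivative f' x) (at x)"
    using abs_cont_FTC[OF acf c_const] by metis
  define W where "W x = (profile (F x))\<^sup>2 / p x * (f' x)\<^sup>2" for x
  have unclamp: "(\<phi> has_real_derivative d) (at x)"
    if "((\<lambda>x. \<phi> (?c x)) has_real_derivative d) (at x)" "x \<in> {a<..<b}" for \<phi> d x
  proof -
    have "\<forall>\<^sub>F y in nhds x. y \<in> {a<..<b}" using that(2) by (intro eventually_nhds_in_open) auto
    then have "\<forall>\<^sub>F y in nhds x. \<phi> (?c y) = \<phi> y" by eventually_elim (use c(4) in auto)
    then show ?thesis using that(1) by (subst (asm) DERIV_cong_ev[OF refl _ refl]) auto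
  qed
  have in_ab: "AE x in lborel. x \<in> {a..b} \<longrightarrow> x \<in> {a<..<b}"
    using AE_lborel_singleton[of a] AE_lborel_singleton[of b] by eventually_elim auto
  \<comment> \<open>The pointwise inequality holds where \<open>f\<close>, \<open>h\<close>, \<open>F\<close> and \<open>G\<close> are differentiable and neither
      distribution function equals 1/2.\<close>
  have key: "AE x in lborel. x \<in> {a..b} \<longrightarrow>
      deriv f x = f' x \<and> (f x)\<^sup>2 * p x * ln ((f x)\<^sup>2 / Z) \<le> g x + W x"
    using in_ab g3 f'(2) P.cdf_has_derivative_AE Q.cdf_has_derivative_AE
      P.cdf_neq_AE[of "1/2"] Q.cdf_neq_AE[of "1/2"]
  proof eventually_elim
    case (elim x)
    show ?case
    proof
      assume "x \<in> {a..b}"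
      then have x: "x \<in> {a<..<b}" using elim(1) by blast
      have df: "(f has_real_derivative f' x) (at x)" by (rule unclamp[OF elim(3) x])
      have dh: "(h has_real_derivative g x) (at x)" by (rule unclamp[OF elim(2) x])
      have dF: "(F has_real_derivative p x) (at x)" using elim(4) unfolding F_def .
      have dG: "(G has_real_derivative (f x)\<^sup>2 / Z * p x) (at x)" using elim(5) unfolding G_def by simp
      have neq: "F x \<noteq> 1/2" "G x \<noteq> 1/2" using elim(6,7) unfolding F_def G_def by auto
      note qF = quantile_profile_has_derivative[OF F(2,3) neq(1)]
        and qG = quantile_profile_has_derivative[OF G(2,3) neq(2)]
      let ?I = "profile (F x)" and ?J = "profile (G x)" and ?S = "potential_slope (quantile (F x))"
        and ?R = "(f x)\<^sup>2 / Z" and ?\<theta> = "quantile (G x) - quantile (F x)"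
      have d1: "((\<lambda>x. (f x)\<^sup>2) has_real_derivative 2 * f x * f' x) (at x)"
        using DERIV_power[OF df, of 2] by (simp add: mult.commute mult.left_commute)
      have d2: "((\<lambda>x. quantile (G x) - quantile (F x)) has_real_derivative
          (1 / ?J) * (?R * p x) - (1 / ?I) * p x) (at x)"
        by (intro DERIV_diff DERIV_chain2[OF qG(1) dG] DERIV_chain2[OF qF(1) dF])
      have "(h has_real_derivative (2 * f x * f' x) * (?I * ?\<theta>)
          + ((- ?S * p x) * ?\<theta> + ((1 / ?J) * (?R * p x) - (1 / ?I) * p x) * ?I) * (f x)\<^sup>2) (at x)"
        unfolding h_def by (rule DERIV_mult[OF d1 DERIV_mult[OF DERIV_chain2[OF qF(2) dF] d2]])
      then have gx: "g x = (2 * f x * f' x) * (?I * ?\<theta>)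
          + ((- ?S * p x) * ?\<theta> + ((1 / ?J) * (?R * p x) - (1 / ?I) * p x) * ?I) * (f x)\<^sup>2"
        by (rule DERIV_unique[OF dh])
      have "ln ?R \<le> ?R * ?I / ?J - 1 - ?S * ?\<theta> - ?\<theta>\<^sup>2"
        using f_pos[of x] Z by (intro transport_log_inequality[OF F(2,3) G(2,3)]) auto
      from completing_square[OF P.r_pos profile_pos[OF F(2,3)] this, of "f x" x "f' x"]
      have "(f x)\<^sup>2 * p x * ln ?R - W x \<le> g x"
        unfolding gx W_def .
      then show "deriv f x = f' x \<and> (f x)\<^sup>2 * p x * ln ((f x)\<^sup>2 / Z) \<le> g x + W x"
        using DERIV_imp_deriv[OF df] by simp
    qed
  qed
  have W_nonneg: "0 \<le> W x" for x unfolding W_def using P.r_pos[of x] by simp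
  have F_meas: "F \<in> borel_measurable borel" using F(1) by (rule borel_measurable_mono)
  have pF_meas: "(\<lambda>x. profile (F x)) \<in> borel_measurable borel"
    by (rule measurable_compose[OF F_meas profile_borel_measurable])
  have W_meas: "W \<in> borel_measurable borel"
    unfolding W_def[abs_def] using pF_meas P.r_measurable f'(1)
    by (intro borel_measurable_times borel_measurable_divide borel_measurable_power)
  have "(\<integral>\<^sup>+ x. ennreal (indicator {a..b} x * W x) \<partial>lborel)
      \<le> (\<integral>\<^sup>+ x. ennreal ((profile (F x))\<^sup>2 / p x * (deriv f x)\<^sup>2) \<partial>lborel)"
    using key by (intro nn_integral_mono_AE, eventually_elim) (auto simp: W_def indicator_def)
  also have "\<dots> \<le> ennreal B" by (rule B(1))
  finally have W_le: "(\<integral>\<^sup>+ x. ennreal (indicator {a..b} x * W x) \<partial>lborel) \<le> ennreal B" .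
  have W_int: "set_integrable lborel {a..b} W"
    unfolding set_integrable_def real_scaleR_def
  proof (rule integrableI_nonneg)
    show "(\<lambda>x. indicator {a..b} x * W x) \<in> borel_measurable lborel" using W_meas by simp
    show "AE x in lborel. 0 \<le> indicator {a..b} x * W x" using W_nonneg by auto
    show "(\<integral>\<^sup>+ x. ennreal (indicator {a..b} x * W x) \<partial>lborel) < \<infinity>"
      using W_le by (simp add: le_less_trans)
  qed
  have "ennreal (LINT x:{a..b}|lborel. W x) = (\<integral>\<^sup>+ x. ennreal (indicator {a..b} x * W x) \<partial>lborel)"
    using W_int W_nonneg unfolding set_integrable_def set_lebesgue_integral_def real_scaleR_def
    by (intro nn_integral_eq_integral[symmetric]) auto
  then have "ennreal (LINT x:{a..b}|lborel. W x) \<le> ennreal B" using W_le by simp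
  then have W_B: "(LINT x:{a..b}|lborel. W x) \<le> B" using B(2) by simp
  have "(LINT x:{a..b}|lborel. (f x)\<^sup>2 * p x * ln ((f x)\<^sup>2 / Z)) \<le> (LINT x:{a..b}|lborel. g x + W x)"
    using key by (intro set_integral_mono_AE L_int set_integral_add(1) g(1) W_int) (auto elim: eventually_mono)
  also have "\<dots> = (h b - h a) + (LINT x:{a..b}|lborel. W x)"
    using g(1,2) W_int by (simp add: set_integral_add(2))
  also have "\<dots> \<le> (h b - h a) + B" using W_B by simp
  finally show ?thesis by simp
qed

section \<open>Differentiability of absolutely continuous functions\<close>

lemma absolutely_continuous_real_clamp:
  assumes "absolutely_continuous_real f" "a \<le> b"
  shows "abs_cont (\<lambda>x. f (clamp_to a b x))"
  using assms unfolding absolutely_continuous_real_def by (intro abs_cont_clamp) auto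

lemma eventually_clamp_to_eq:
  assumes "x \<in> {a<..<b}"
  shows "\<forall>\<^sub>F y in nhds x. \<phi> (clamp_to a b y) = \<phi> y"
proof -
  have "\<forall>\<^sub>F y in nhds x. y \<in> {a<..<b}" using assms by (intro eventually_nhds_in_open) auto
  then show ?thesis by eventually_elim (auto simp: clamp_to_def)
qed

lemma absolutely_continuous_real_continuous:
  assumes f: "absolutely_continuous_real f"
  shows "continuous_on UNIV f"
proof (rule continuous_at_imp_continuous_on, rule ballI)
  fix x :: real
  have "isCont (\<lambda>y. f (clamp_to (x - 1) (x + 1) y)) x"
    using abs_cont_imp_continuous[OF absolutely_continuous_real_clamp[OF f, of "x - 1" "x + 1"]]
    by (simp add: continuous_on_eq_continuous_at)
  moreover have "\<forall>\<^sub>F y in nhds x. f (clamp_to (x - 1) (x + 1) y) = f y"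
    by (rule eventually_clamp_to_eq) simp
  ultimately show "isCont f x"
    using isCont_cong[where f="\<lambda>y. f (clamp_to (x - 1) (x + 1) y)" and g=f and x=x] by simp
qed

lemma absolutely_continuous_real_differentiable_AE:
  assumes f: "absolutely_continuous_real f"
  shows "AE x in lborel. (f has_real_derivative deriv f x) (at x)"
proof -
  have loc: "AE x in lborel. x \<in> {- real n<..<real n} \<longrightarrow> (f has_real_derivative deriv f x) (at x)" for n
  proof -
    have n: "- real n \<le> real n" by simp
    have const: "\<forall>x\<le>- real n. f (clamp_to (- real n) (real n) x) = f (clamp_to (- real n) (real n) (- real n))"
      using clamp_to_props(5)[OF n] by (metis order_refl)
    obtain f' where "AE x in lborel. ((\<lambda>x. f (clamp_to (- real n) (real n) x)) has_real_derivative f' x) (at x)"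
      using abs_cont_FTC[OF absolutely_continuous_real_clamp[OF f n] const] by metis
    then show ?thesis
    proof eventually_elim
      case (elim x)
      show ?case
      proof
        assume "x \<in> {- real n<..<real n}"
        from eventually_clamp_to_eq[OF this, of f] elim have "(f has_real_derivative f' x) (at x)"
          by (subst (asm) DERIV_cong_ev[OF refl _ refl]) auto
        then show "(f has_real_derivative deriv f x) (at x)" by (simp add: DERIV_imp_deriv)
      qed
    qed
  qed
  have "AE x in lborel. \<forall>n. x \<in> {- real n<..<real n} \<longrightarrow> (f has_real_derivative deriv f x) (at x)"
    unfolding AE_all_countable using loc by blast
  then show ?thesis
  proof eventually_elim
    case (elim x)
    obtain n :: nat where "\<bar>x\<bar> < real n" using reals_Archimedean2 by blast
    then have "x \<in> {- real n<..<real n}" by auto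
    then show ?case using elim by blast
  qed
qed

lemma absolutely_continuous_real_contraction:
  assumes f: "absolutely_continuous_real f" and le: "\<And>x y. \<bar>k y - k x\<bar> \<le> \<bar>f y - f x\<bar>"
  shows "absolutely_continuous_real k"
proof -
  have sum_le: "(\<Sum>i<n. \<bar>k (v i) - k (u i)\<bar>) \<le> (\<Sum>i<n. \<bar>f (v i) - f (u i)\<bar>)" for n :: nat and u v
    by (intro sum_mono le)
  show ?thesis
    unfolding absolutely_continuous_real_def absolutely_continuous_interval_def
  proof (intro allI impI)
    fix a b \<epsilon> :: real assume "a \<le> b" "0 < \<epsilon>"
    then obtain \<delta> where "\<delta> > 0" "\<forall>(n::nat) (u::nat \<Rightarrow> real) (v::nat \<Rightarrow> real).
        (\<forall>i<n. a \<le> u i \<and> u i \<le> v i \<and> v i \<le> b) \<and>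
        disjoint_family_on (\<lambda>i. {u i<..<v i}) {..<n} \<and>
        (\<Sum>i<n. v i - u i) < \<delta> \<longrightarrow> (\<Sum>i<n. \<bar>f (v i) - f (u i)\<bar>) < \<epsilon>"
      using f unfolding absolutely_continuous_real_def absolutely_continuous_interval_def by meson
    then show "\<exists>\<delta>>0. \<forall>(n::nat) (u::nat \<Rightarrow> real) (v::nat \<Rightarrow> real).
        (\<forall>i<n. a \<le> u i \<and> u i \<le> v i \<and> v i \<le> b) \<and>
        disjoint_family_on (\<lambda>i. {u i<..<v i}) {..<n} \<and>
        (\<Sum>i<n. v i - u i) < \<delta> \<longrightarrow> (\<Sum>i<n. \<bar>k (v i) - k (u i)\<bar>) < \<epsilon>"
      using sum_le by (meson le_less_trans)
  qed
qed

lemma DERIV_contraction: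
  fixes f k :: "real \<Rightarrow> real"
  assumes le: "\<And>x y. \<bar>k y - k x\<bar> \<le> \<bar>f y - f x\<bar>"
    and f: "(f has_real_derivative d) (at x)" and k: "(k has_real_derivative d') (at x)"
  shows "\<bar>d'\<bar> \<le> \<bar>d\<bar>"
proof (rule tendsto_le)
  show "((\<lambda>h. \<bar>(f (x + h) - f x) / h\<bar>) \<longlongrightarrow> \<bar>d\<bar>) (at 0)"
    using f unfolding DERIV_def by (rule tendsto_rabs)
  show "((\<lambda>h. \<bar>(k (x + h) - k x) / h\<bar>) \<longlongrightarrow> \<bar>d'\<bar>) (at 0)"
    using k unfolding DERIV_def by (rule tendsto_rabs)
  show "\<forall>\<^sub>F h in at 0. \<bar>(k (x + h) - k x) / h\<bar> \<le> \<bar>(f (x + h) - f x) / h\<bar>"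
    by (rule always_eventually) (auto intro!: divide_right_mono le)
qed simp

text \<open>Measurability is obtained from the limit of the continuous difference quotients, which agrees with
\<open>deriv f\<close> wherever \<open>f\<close> is differentiable.\<close>

lemma deriv_eq_borel_AE:
  assumes f: "absolutely_continuous_real f"
  obtains d where "d \<in> borel_measurable borel" "AE x in lborel. deriv f x = d x"
proof
  let ?q = "\<lambda>n x. (f (x + inverse (real (Suc n))) - f x) / inverse (real (Suc n))"
  have fm: "f \<in> borel_measurable borel"
    by (rule borel_measurable_continuous_onI[OF absolutely_continuous_real_continuous[OF f]])
  have "(\<lambda>x. f (x + c)) \<in> borel_measurable borel" for c
    by (rule measurable_compose[OF _ fm]) simp
  then have "?q n \<in> borel_measurable borel" for n
    using fm by (intro borel_measurable_divide borel_measurable_diff) auto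
  then show "(\<lambda>x. lim (\<lambda>n. ?q n x)) \<in> borel_measurable borel"
    by (rule borel_measurable_lim_metric)
  show "AE x in lborel. deriv f x = lim (\<lambda>n. ?q n x)"
    using absolutely_continuous_real_differentiable_AE[OF f]
  proof eventually_elim
    case (elim x)
    have "filterlim (\<lambda>n. inverse (real (Suc n))) (at 0) sequentially"
      using LIMSEQ_inverse_real_of_nat by (simp add: filterlim_at)
    with elim have "(\<lambda>n. ?q n x) \<longlonglongrightarrow> deriv f x"
      unfolding DERIV_def by (rule filterlim_compose)
    then show ?case by (simp add: limI)
  qed
qed

section \<open>The entropy inequality for bounded functions\<close>

text \<open>For \<open>\<epsilon> \<le> f \<le> M\<close> the densities \<open>p\<close> and \<open>f\<^sup>2 * p / Z\<close> differ at most by the factor \<open>c = M\<^sup>2 / \<epsilon>\<^sup>2\<close>.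
So \<open>\<theta>\<close> is bounded by \<open>2 * ln c\<close>, and \<open>h\<close> tends to 0 at both ends because the profile does.\<close>

lemma log_sobolev_bounded:
  fixes f p :: "real \<Rightarrow> real" and \<epsilon> M B :: real
  defines "Z \<equiv> (\<integral>x. (f x)\<^sup>2 * p x \<partial>lborel)"
  assumes P: "positive_density p" and f: "absolutely_continuous_real f"
    and bounds: "0 < \<epsilon>" "\<And>x. \<epsilon> \<le> f x" "\<And>x. f x \<le> M"
    and B: "(\<integral>\<^sup>+ x. ennreal ((profile (cdf (density lborel p) x))\<^sup>2 / p x * (deriv f x)\<^sup>2) \<partial>lborel) \<le> ennreal B" "0 \<le> B"
  shows "integrable lborel (\<lambda>x. (f x)\<^sup>2 * p x)" "0 < Z"
    "integrable lborel (\<lambda>x. (f x)\<^sup>2 * p x * ln ((f x)\<^sup>2 / Z))"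
    "(\<integral>x. (f x)\<^sup>2 * p x * ln ((f x)\<^sup>2 / Z) \<partial>lborel) \<le> B"
proof -
  interpret P: positive_density p by fact
  have fm [measurable]: "f \<in> borel_measurable borel"
    by (rule borel_measurable_continuous_onI[OF absolutely_continuous_real_continuous[OF f]])
  have f2: "\<epsilon>\<^sup>2 \<le> (f x)\<^sup>2" "(f x)\<^sup>2 \<le> M\<^sup>2" for x
    using bounds(1) bounds(2,3)[of x] by (auto intro!: power_mono)
  have pos: "0 < \<epsilon>\<^sup>2" "0 < M\<^sup>2" using bounds(1) f2(1,2)[of 0] by auto
  show int: "integrable lborel (\<lambda>x. (f x)\<^sup>2 * p x)"
  proof (rule Bochner_Integration.integrable_bound)
    show "integrable lborel (\<lambda>x. M\<^sup>2 * p x)" using P.integrable_r by simp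
    show "AE x in lborel. norm ((f x)\<^sup>2 * p x) \<le> norm (M\<^sup>2 * p x)"
      using f2(2) P.r_pos by (intro AE_I2) (simp add: abs_mult mult_right_mono)
  qed simp
  have one: "(\<integral>x. p x \<partial>lborel) = 1" using P.has_bochner_integral_r by (simp add: has_bochner_integral_iff)
  have "(\<integral>x. \<epsilon>\<^sup>2 * p x \<partial>lborel) \<le> Z"
    unfolding Z_def using P.integrable_r int f2 P.r_pos
    by (intro integral_mono) (auto intro!: mult_right_mono less_imp_le)
  then have Z_low: "\<epsilon>\<^sup>2 \<le> Z" using one by simp
  have "Z \<le> (\<integral>x. M\<^sup>2 * p x \<partial>lborel)"
    unfolding Z_def using P.integrable_r int f2 P.r_pos
    by (intro integral_mono) (auto intro!: mult_right_mono less_imp_le)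
  then have Z_up: "Z \<le> M\<^sup>2" using one by simp
  show Z: "0 < Z" using Z_low pos by linarith
  have Q: "positive_density (\<lambda>x. (f x)\<^sup>2 * p x / Z)"
  proof (rule positive_density.intro)
    show "(\<lambda>x. (f x)\<^sup>2 * p x / Z) \<in> borel_measurable borel" by simp
    show r_pos: "0 < (f x)\<^sup>2 * p x / Z" for x
    proof -
      have "0 < (f x)\<^sup>2" using f2(1)[of x] pos(1) by linarith
      then show ?thesis using P.r_pos[of x] Z by simp
    qed
    show "prob_space (density lborel (\<lambda>x. ennreal ((f x)\<^sup>2 * p x / Z)))"
    proof (rule prob_spaceI)
      have "(\<integral>\<^sup>+ x. ennreal ((f x)\<^sup>2 * p x / Z) \<partial>lborel) = ennreal (\<integral>x. (f x)\<^sup>2 * p x / Z \<partial>lborel)"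
        using int r_pos by (intro nn_integral_eq_integral) (auto intro: less_imp_le)
      also have "(\<integral>x. (f x)\<^sup>2 * p x / Z \<partial>lborel) = 1" using Z by (simp flip: Z_def)
      finally show "emeasure (density lborel (\<lambda>x. ennreal ((f x)\<^sup>2 * p x / Z)))
         (space (density lborel (\<lambda>x. ennreal ((f x)\<^sup>2 * p x / Z)))) = 1"
        by (simp add: emeasure_density)
    qed
  qed
  define c where "c = M\<^sup>2 / \<epsilon>\<^sup>2"
  have ratio: "(f x)\<^sup>2 / Z \<le> c" "1 \<le> c * ((f x)\<^sup>2 / Z)" for x
  proof -
    show "(f x)\<^sup>2 / Z \<le> c" unfolding c_def using f2(2)[of x] Z_low pos by (intro frac_le) auto
    have "\<epsilon>\<^sup>2 / M\<^sup>2 \<le> (f x)\<^sup>2 / Z" using f2(1)[of x] Z_up Z pos by (intro frac_le) auto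
    then have "c * (\<epsilon>\<^sup>2 / M\<^sup>2) \<le> c * ((f x)\<^sup>2 / Z)" unfolding c_def using pos by (intro mult_left_mono) auto
    moreover have "c * (\<epsilon>\<^sup>2 / M\<^sup>2) = 1" unfolding c_def using pos by simp
    ultimately show "1 \<le> c * ((f x)\<^sup>2 / Z)" by linarith
  qed
  define F where "F = cdf (density lborel (\<lambda>x. ennreal (p x)))"
  define G where "G = cdf (density lborel (\<lambda>x. ennreal ((f x)\<^sup>2 * p x / Z)))"
  have \<theta>: "\<bar>quantile (G x) - quantile (F x)\<bar> \<le> 2 * ln c" for x
    unfolding F_def G_def
  proof (rule quantile_cdf_diff_le_ln_ratio[OF P Q])
    show "(f x)\<^sup>2 * p x / Z \<le> c * p x" for x
      using mult_right_mono[OF ratio(1)[of x] less_imp_le[OF P.r_pos[of x]]] by simp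
    show "p x \<le> c * ((f x)\<^sup>2 * p x / Z)" for x
      using mult_right_mono[OF ratio(2)[of x] less_imp_le[OF P.r_pos[of x]]] by (simp add: mult.assoc)
  qed
  have c_pos: "0 < c" unfolding c_def using pos by simp
  have ln_bound: "\<bar>ln ((f x)\<^sup>2 / Z)\<bar> \<le> ln c" for x
  proof -
    have "0 < (f x)\<^sup>2" using f2(1)[of x] pos(1) by linarith
    then have q: "0 < (f x)\<^sup>2 / Z" using Z by simp
    have "ln ((f x)\<^sup>2 / Z) \<le> ln c" using ratio(1)[of x] q c_pos by simp
    moreover have "0 \<le> ln (c * ((f x)\<^sup>2 / Z))" using ratio(2)[of x] by simp
    then have "0 \<le> ln c + ln ((f x)\<^sup>2 / Z)" using ln_mult_pos[OF c_pos q] by simp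
    ultimately show ?thesis by simp
  qed
  let ?L = "\<lambda>x. (f x)\<^sup>2 * p x * ln ((f x)\<^sup>2 / Z)"
  show L_int: "integrable lborel ?L"
  proof (rule Bochner_Integration.integrable_bound)
    show "integrable lborel (\<lambda>x. (f x)\<^sup>2 * p x * ln c)" using int by simp
    show "AE x in lborel. norm (?L x) \<le> norm ((f x)\<^sup>2 * p x * ln c)"
    proof (rule AE_I2)
      fix x
      have "\<bar>ln ((f x)\<^sup>2 / Z)\<bar> \<le> \<bar>ln c\<bar>" using ln_bound[of x] by linarith
      then show "norm (?L x) \<le> norm ((f x)\<^sup>2 * p x * ln c)"
        unfolding real_norm_def abs_mult by (intro mult_left_mono) auto
    qed
  qed simp
  define h where "h x = (f x)\<^sup>2 * (profile (F x) * (quantile (G x) - quantile (F x)))" for x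
  have h_bound: "\<bar>h x\<bar> \<le> M\<^sup>2 * (sqrt (2 * min (F x) (1 - F x)) * (2 * ln c))" for x
  proof -
    have F01: "0 < F x" "F x < 1" unfolding F_def using P.cdf_between by auto
    have "\<bar>profile (F x) * (quantile (G x) - quantile (F x))\<bar> \<le> sqrt (2 * min (F x) (1 - F x)) * (2 * ln c)"
      unfolding abs_mult using profile_bound[OF F01] profile_pos[OF F01] \<theta>[of x] F01
      by (intro mult_mono) auto
    from mult_mono[OF f2(2)[of x] this] have
      "(f x)\<^sup>2 * \<bar>profile (F x) * (quantile (G x) - quantile (F x))\<bar>
        \<le> M\<^sup>2 * (sqrt (2 * min (F x) (1 - F x)) * (2 * ln c))" by simp
    moreover have "\<bar>h x\<bar> = (f x)\<^sup>2 * \<bar>profile (F x) * (quantile (G x) - quantile (F x))\<bar>"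
      unfolding h_def by (subst abs_mult) simp
    ultimately show ?thesis by (simp only:)
  qed
  have h_lim: "(\<lambda>n. h (s n)) \<longlonglongrightarrow> 0" if "(\<lambda>n. min (F (s n)) (1 - F (s n))) \<longlonglongrightarrow> 0" for s :: "nat \<Rightarrow> real"
  proof (rule Lim_null_comparison)
    show "\<forall>\<^sub>F n in sequentially. norm (h (s n)) \<le> M\<^sup>2 * (sqrt (2 * min (F (s n)) (1 - F (s n))) * (2 * ln c))"
      using h_bound by (intro always_eventually) simp
    have "(\<lambda>n. M\<^sup>2 * (sqrt (2 * min (F (s n)) (1 - F (s n))) * (2 * ln c))) \<longlonglongrightarrow> M\<^sup>2 * (sqrt (2 * 0) * (2 * ln c))"
      by (intro tendsto_mult tendsto_const tendsto_real_sqrt that)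
    then show "(\<lambda>n. M\<^sup>2 * (sqrt (2 * min (F (s n)) (1 - F (s n))) * (2 * ln c))) \<longlonglongrightarrow> 0" by simp
  qed
  have step: "(LINT x:{- real n..real n}|lborel. ?L x) \<le> h (real n) - h (- real n) + B" if "n > 0" for n
    unfolding h_def F_def G_def
  proof (rule log_sobolev_on_interval[OF P Q f bounds Z _ B])
    show "- real n < real n" using that by simp
    show "set_integrable lborel {- real n..real n} ?L"
      using L_int unfolding set_integrable_def by (intro integrable_mult_indicator) auto
  qed
  have "(\<lambda>n. LINT x:{- real n..real n}|lborel. ?L x) \<longlonglongrightarrow> (\<integral>x. ?L x \<partial>lborel)"
    unfolding set_lebesgue_integral_def
  proof (rule integral_dominated_convergence[where w="\<lambda>x. \<bar>?L x\<bar>"])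
    show "integrable lborel (\<lambda>x. \<bar>?L x\<bar>)" using L_int by (rule integrable_abs)
    show "AE x in lborel. (\<lambda>n. indicator {- real n..real n} x *\<^sub>R ?L x) \<longlonglongrightarrow> ?L x"
    proof (rule AE_I2)
      fix x :: real
      obtain m :: nat where "\<bar>x\<bar> \<le> real m" using real_arch_simple by blast
      then have "\<forall>\<^sub>F n in sequentially. indicator {- real n..real n} x *\<^sub>R ?L x = ?L x"
        by (intro eventually_sequentiallyI[of m]) (auto simp: indicator_def abs_le_iff)
      then show "(\<lambda>n. indicator {- real n..real n} x *\<^sub>R ?L x) \<longlonglongrightarrow> ?L x"
        by (rule tendsto_eventually)
    qed
    show "AE x in lborel. norm (indicator {- real n..real n} x *\<^sub>R ?L x) \<le> \<bar>?L x\<bar>" for n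
      by (intro AE_I2) (simp add: indicator_def)
  qed simp_all
  moreover have "(\<lambda>n. h (real n) - h (- real n) + B) \<longlonglongrightarrow> 0 - 0 + B"
    using P.min_cdf_tendsto_0 unfolding F_def[symmetric] by (intro tendsto_intros h_lim)
  ultimately have "(\<integral>x. ?L x \<partial>lborel) \<le> 0 - 0 + B"
    using step by (intro LIMSEQ_le) (auto intro!: exI[of _ 1])
  then show "(\<integral>x. ?L x \<partial>lborel) \<le> B" by simp
qed

section \<open>Truncation and the general case\<close>

lemma x_ln_x_ge: "0 \<le> t \<Longrightarrow> - 1 \<le> t * ln (t::real)"
proof (cases "t = 0")
  case False
  assume "0 \<le> t"
  then have t: "0 < t" using False by simp
  have "ln (1 / t) \<le> 1 / t - 1" using t by (intro ln_le_minus_one) simp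
  then have "t * (1 - 1 / t) \<le> t * ln t" using t by (intro mult_left_mono) (auto simp: ln_div)
  then show ?thesis using t by (simp add: algebra_simps)
qed simp

lemma tendsto_x_ln_x:
  fixes s :: "nat \<Rightarrow> real"
  assumes s: "s \<longlonglongrightarrow> t" "\<And>n. 0 \<le> s n"
  shows "(\<lambda>n. s n * ln (s n)) \<longlonglongrightarrow> t * ln t"
proof (cases "t = 0")
  case False
  then show ?thesis using s(1) by (intro tendsto_intros)
next
  case True
  have bound: "\<bar>x * ln x\<bar> \<le> 2 * sqrt x + x\<^sup>2" if "0 \<le> x" for x :: real
  proof (cases "x = 0")
    case False
    then have x: "0 < x" "0 < sqrt x" using that by auto
    have "x * ln x \<le> x * x" using x ln_le_minus_one[of x] by (intro mult_left_mono) auto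
    moreover have "x * (- ln x) \<le> 2 * sqrt x"
    proof -
      have "ln (1 / sqrt x) \<le> 1 / sqrt x - 1" using x by (intro ln_le_minus_one) simp
      then have "- ln x \<le> 2 * (1 / sqrt x)" using x by (simp add: ln_div ln_sqrt)
      then have "x * (- ln x) \<le> x * (2 * (1 / sqrt x))" using x by (intro mult_left_mono) auto
      also have "\<dots> = 2 * (x / sqrt x)" by simp
      also have "\<dots> = 2 * sqrt x" using x by (simp only: real_div_sqrt less_imp_le)
      finally show ?thesis .
    qed
    moreover have "0 \<le> x * x" "0 \<le> 2 * sqrt x" using x by auto
    ultimately show ?thesis unfolding power2_eq_square abs_le_iff by linarith
  qed simp
  have "(\<lambda>n. s n * ln (s n)) \<longlonglongrightarrow> 0"
  proof (rule Lim_null_comparison)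
    show "\<forall>\<^sub>F n in sequentially. norm (s n * ln (s n)) \<le> 2 * sqrt (s n) + (s n)\<^sup>2"
      using bound s(2) by (intro always_eventually) simp
    have "(\<lambda>n. 2 * sqrt (s n) + (s n)\<^sup>2) \<longlonglongrightarrow> 2 * sqrt t + t\<^sup>2"
      by (intro tendsto_intros s(1))
    then show "(\<lambda>n. 2 * sqrt (s n) + (s n)\<^sup>2) \<longlonglongrightarrow> 0" using True by simp
  qed
  then show ?thesis using True by simp
qed

text \<open>The factor 2 is where the constant 8 of the weight meets the constant 4 of \<open>profile_square\<close>.\<close>

lemma K_weight_eq_profile:
  assumes "positive_density p"
  defines "\<mu> \<equiv> density lborel (\<lambda>x. ennreal (p x))"
  shows "p x * K_weight \<mu> p x = 2 * ((profile (cdf \<mu> x))\<^sup>2 / p x)"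
proof -
  interpret P: positive_density p by fact
  show ?thesis
    unfolding K_weight_def F_hat_def \<mu>_def profile_square[OF P.cdf_between]
    using P.r_pos[of x] by (simp add: power2_eq_square)
qed

text \<open>Cutting off \<open>\<bar>y\<bar>\<close> at both sides by one contraction keeps absolute continuity and does not increase
the derivative. The successor avoids a division by zero.\<close>

definition truncation :: "nat \<Rightarrow> real \<Rightarrow> real" where
  "truncation n y = max (1 / real (Suc n)) (min (real (Suc n)) \<bar>y\<bar>)"

lemma truncation_bounds:
  "0 < 1 / real (Suc n)" "1 / real (Suc n) \<le> truncation n y" "truncation n y \<le> real (Suc n)"
  unfolding truncation_def by (auto simp: field_simps)

lemma truncation_contraction: "\<bar>truncation n y - truncation n x\<bar> \<le> \<bar>y - x\<bar>"
  unfolding truncation_def by linarith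

lemma truncation_square_le: "(truncation n y)\<^sup>2 \<le> y\<^sup>2 + 1"
proof -
  have "truncation n y \<le> max 1 \<bar>y\<bar>"
    unfolding truncation_def by (intro max.mono min.cobounded2) simp
  then have "(truncation n y)\<^sup>2 \<le> (max 1 \<bar>y\<bar>)\<^sup>2"
    using truncation_bounds(1)[of n] truncation_bounds(2)[of n y] by (intro power_mono) linarith+
  also have "\<dots> \<le> y\<^sup>2 + 1" by (simp add: max_def)
  finally show ?thesis .
qed

lemma truncation_tendsto: "(\<lambda>n. truncation n y) \<longlonglongrightarrow> \<bar>y\<bar>"
proof -
  obtain m :: nat where m: "\<bar>y\<bar> \<le> real m" using real_arch_simple by blast
  have "(\<lambda>n. max (1 / real (Suc n)) \<bar>y\<bar>) \<longlonglongrightarrow> max 0 \<bar>y\<bar>"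
    using LIMSEQ_inverse_real_of_nat by (intro tendsto_intros) (simp add: inverse_eq_divide)
  moreover have "\<forall>\<^sub>F n in sequentially. max (1 / real (Suc n)) \<bar>y\<bar> = truncation n y"
    using m by (intro eventually_sequentiallyI[of m]) (simp add: truncation_def)
  ultimately show ?thesis by (simp add: tendsto_cong)
qed

text \<open>The weighted integral for the truncated function is controlled by the one for \<open>f\<close>, so the bound
\<open>B\<close> does not depend on the truncation level.\<close>

lemma log_sobolev_truncated:
  fixes f p :: "real \<Rightarrow> real" and B :: real
  defines "\<mu> \<equiv> density lborel (\<lambda>x. ennreal (p x))"
  assumes P: "positive_density p" and f: "absolutely_continuous_real f"
    and B: "(\<integral>\<^sup>+ x. ennreal (K_weight \<mu> p x * (deriv f x)\<^sup>2) \<partial>\<mu>) \<le> ennreal B" "0 \<le> B"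
  shows "integrable \<mu> (\<lambda>x. (truncation n (f x))\<^sup>2 * ln ((truncation n (f x))\<^sup>2))"
    and "(\<integral>x. (truncation n (f x))\<^sup>2 * ln ((truncation n (f x))\<^sup>2) \<partial>\<mu>)
       \<le> B + (\<integral>x. (truncation n (f x))\<^sup>2 \<partial>\<mu>) * ln (\<integral>x. (truncation n (f x))\<^sup>2 \<partial>\<mu>)"
proof -
  interpret P: positive_density p by fact
  let ?k = "\<lambda>x. truncation n (f x)"
  have contr: "\<bar>?k y - ?k x\<bar> \<le> \<bar>f y - f x\<bar>" for x y by (rule truncation_contraction)
  have k: "absolutely_continuous_real ?k"
    by (rule absolutely_continuous_real_contraction[OF f contr])
  have km [measurable]: "?k \<in> borel_measurable borel"
    by (rule borel_measurable_continuous_onI[OF absolutely_continuous_real_continuous[OF k]])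
  have F_meas: "cdf \<mu> \<in> borel_measurable borel"
    unfolding \<mu>_def by (rule borel_measurable_mono[OF P.mono_cdf])
  obtain d where d [measurable]: "d \<in> borel_measurable borel" and d_eq: "AE x in lborel. deriv f x = d x"
    using deriv_eq_borel_AE[OF f] by blast
  have I_meas: "(\<lambda>x. (profile (cdf \<mu> x))\<^sup>2 / p x) \<in> borel_measurable borel"
    using measurable_compose[OF F_meas profile_borel_measurable] P.r_measurable
    by (intro borel_measurable_divide borel_measurable_power)
  have K_pos: "0 \<le> K_weight \<mu> p x" for x
  proof -
    have "0 \<le> p x * K_weight \<mu> p x"
      unfolding \<mu>_def K_weight_eq_profile[OF P] using P.r_pos[of x] by simp
    then show ?thesis using P.r_pos[of x] by (simp add: zero_le_mult_iff)
  qed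
  have K_eq: "K_weight \<mu> p x = 2 * ((profile (cdf \<mu> x))\<^sup>2 / p x) / p x" for x
    using K_weight_eq_profile[OF P, of x] P.r_pos[of x] unfolding \<mu>_def
    by (metis less_irrefl nonzero_mult_div_cancel_left)
  have K_meas: "(\<lambda>x. K_weight \<mu> p x) \<in> borel_measurable borel"
    unfolding K_eq
    by (rule borel_measurable_divide[OF borel_measurable_times[OF borel_measurable_const I_meas] P.r_measurable])
  have "(\<integral>\<^sup>+ x. ennreal ((profile (cdf \<mu> x))\<^sup>2 / p x * (deriv ?k x)\<^sup>2) \<partial>lborel)
      \<le> (\<integral>\<^sup>+ x. ennreal (p x) * ennreal (K_weight \<mu> p x * (d x)\<^sup>2) \<partial>lborel)"
  proof (rule nn_integral_mono_AE)
    show "AE x in lborel. ennreal ((profile (cdf \<mu> x))\<^sup>2 / p x * (deriv ?k x)\<^sup>2)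
        \<le> ennreal (p x) * ennreal (K_weight \<mu> p x * (d x)\<^sup>2)"
      using absolutely_continuous_real_differentiable_AE[OF f]
        absolutely_continuous_real_differentiable_AE[OF k] d_eq
    proof eventually_elim
      case (elim x)
      have "\<bar>deriv ?k x\<bar> \<le> \<bar>d x\<bar>"
        using DERIV_contraction[OF contr elim(1,2)] elim(3) by simp
      then have "(deriv ?k x)\<^sup>2 \<le> (d x)\<^sup>2" by (simp add: abs_le_square_iff)
      moreover have I: "0 \<le> (profile (cdf \<mu> x))\<^sup>2 / p x" using P.r_pos[of x] by simp
      ultimately have "(profile (cdf \<mu> x))\<^sup>2 / p x * (deriv ?k x)\<^sup>2 \<le> (2 * ((profile (cdf \<mu> x))\<^sup>2 / p x)) * (d x)\<^sup>2"
        by (intro mult_mono) auto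
      also have "\<dots> = p x * (K_weight \<mu> p x * (d x)\<^sup>2)"
        unfolding \<mu>_def by (simp only: K_weight_eq_profile[OF P, of x, symmetric] mult.assoc)
      finally show ?case
        using P.r_pos[of x] K_pos[of x] by (simp add: ennreal_leI flip: ennreal_mult)
    qed
  qed
  also have "\<dots> = (\<integral>\<^sup>+ x. ennreal (K_weight \<mu> p x * (d x)\<^sup>2) \<partial>\<mu>)"
    unfolding \<mu>_def using K_meas d P.r_measurable
    by (intro nn_integral_density[symmetric]) (auto simp: \<mu>_def)
  also have "\<dots> = (\<integral>\<^sup>+ x. ennreal (K_weight \<mu> p x * (deriv f x)\<^sup>2) \<partial>\<mu>)"
  proof (rule nn_integral_cong_AE)
    have "AE x in \<mu>. deriv f x = d x"
      unfolding \<mu>_def using d_eq by (subst AE_density) auto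
    then show "AE x in \<mu>. ennreal (K_weight \<mu> p x * (d x)\<^sup>2) = ennreal (K_weight \<mu> p x * (deriv f x)\<^sup>2)"
      by eventually_elim simp
  qed
  also note B(1)
  finally have B': "(\<integral>\<^sup>+ x. ennreal ((profile (cdf (density lborel p) x))\<^sup>2 / p x * (deriv ?k x)\<^sup>2) \<partial>lborel) \<le> ennreal B"
    unfolding \<mu>_def .
  define Z where "Z = (\<integral>x. (?k x)\<^sup>2 * p x \<partial>lborel)"
  note LS = log_sobolev_bounded[OF P k truncation_bounds(1)[of n] truncation_bounds(2,3)[of n] B' B(2), folded Z_def]
  have to_\<mu>: "integral\<^sup>L \<mu> \<phi> = (\<integral>x. \<phi> x * p x \<partial>lborel)"
    "integrable \<mu> \<phi> \<longleftrightarrow> integrable lborel (\<lambda>x. \<phi> x * p x)"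
    if "\<phi> \<in> borel_measurable borel" for \<phi> :: "real \<Rightarrow> real"
    unfolding \<mu>_def using that P.r_pos
    by (subst integral_density integrable_density; auto intro: less_imp_le simp: mult.commute)+
  have Z_eq: "(\<integral>x. (?k x)\<^sup>2 \<partial>\<mu>) = Z" unfolding Z_def by (rule to_\<mu>(1)) simp
  have split: "(?k x)\<^sup>2 * ln ((?k x)\<^sup>2) * p x = (?k x)\<^sup>2 * p x * ln ((?k x)\<^sup>2 / Z) + ln Z * ((?k x)\<^sup>2 * p x)" for x
  proof -
    have "0 < ?k x" using truncation_bounds(1)[of n] truncation_bounds(2)[of n "f x"] by linarith
    then have "ln ((?k x)\<^sup>2) = ln ((?k x)\<^sup>2 / Z) + ln Z" using LS(2) by (simp add: ln_div)
    then show ?thesis by (simp only: distrib_left distrib_right mult.commute mult.left_commute)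
  qed
  have m: "(\<lambda>x. (?k x)\<^sup>2 * ln ((?k x)\<^sup>2)) \<in> borel_measurable borel" by simp
  show "integrable \<mu> (\<lambda>x. (?k x)\<^sup>2 * ln ((?k x)\<^sup>2))"
    unfolding to_\<mu>(2)[OF m] split using LS(1,3) by simp
  have "(\<integral>x. (?k x)\<^sup>2 * ln ((?k x)\<^sup>2) \<partial>\<mu>)
      = (\<integral>x. (?k x)\<^sup>2 * p x * ln ((?k x)\<^sup>2 / Z) \<partial>lborel) + ln Z * Z"
    unfolding to_\<mu>(1)[OF m] split using LS(1,3) by (simp flip: Z_def)
  then show "(\<integral>x. (?k x)\<^sup>2 * ln ((?k x)\<^sup>2) \<partial>\<mu>) \<le> B + (\<integral>x. (?k x)\<^sup>2 \<partial>\<mu>) * ln (\<integral>x. (?k x)\<^sup>2 \<partial>\<mu>)"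
    unfolding Z_eq using LS(4) by (simp add: mult.commute)
qed

text \<open>Fatou's lemma applies because \<open>t ln t + 1\<close> is nonnegative and continuous on \<open>t \<ge> 0\<close>.\<close>

lemma integral_x_ln_x_le_liminf:
  fixes M :: "'a measure" and g :: "'a \<Rightarrow> real" and gn :: "nat \<Rightarrow> 'a \<Rightarrow> real"
  assumes M: "prob_space M"
    and g: "\<And>x. 0 \<le> g x" "g \<in> borel_measurable M"
    and gn: "\<And>n x. 0 \<le> gn n x" "\<And>n. gn n \<in> borel_measurable M"
    and conv: "\<And>x. (\<lambda>n. gn n x) \<longlonglongrightarrow> g x"
    and int: "\<And>n. integrable M (\<lambda>x. gn n x * ln (gn n x))"
    and le: "\<And>n. (\<integral>x. gn n x * ln (gn n x) \<partial>M) \<le> C n" and C: "C \<longlonglongrightarrow> C'"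
  shows "integrable M (\<lambda>x. g x * ln (g x))" "(\<integral>x. g x * ln (g x) \<partial>M) \<le> C'"
proof -
  interpret prob_space M by fact
  let ?\<phi> = "\<lambda>t::real. t * ln t"
  have nn: "0 \<le> ?\<phi> t + 1" if "0 \<le> t" for t using x_ln_x_ge[OF that] by simp
  have "(\<integral>\<^sup>+ x. ennreal (?\<phi> (g x) + 1) \<partial>M) = (\<integral>\<^sup>+ x. liminf (\<lambda>n. ennreal (?\<phi> (gn n x) + 1)) \<partial>M)"
  proof (rule nn_integral_cong)
    fix x
    have "(\<lambda>n. ennreal (?\<phi> (gn n x) + 1)) \<longlonglongrightarrow> ennreal (?\<phi> (g x) + 1)"
      by (intro tendsto_ennrealI tendsto_add tendsto_const tendsto_x_ln_x conv gn(1))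
    then show "ennreal (?\<phi> (g x) + 1) = liminf (\<lambda>n. ennreal (?\<phi> (gn n x) + 1))"
      by (simp add: lim_imp_Liminf)
  qed
  also have "\<dots> \<le> liminf (\<lambda>n. \<integral>\<^sup>+ x. ennreal (?\<phi> (gn n x) + 1) \<partial>M)"
    using gn(2) by (intro nn_integral_liminf) auto
  also have "\<dots> \<le> liminf (\<lambda>n. ennreal (C n + 1))"
  proof (intro Liminf_mono always_eventually allI)
    fix n
    have "(\<integral>\<^sup>+ x. ennreal (?\<phi> (gn n x) + 1) \<partial>M) = ennreal (\<integral>x. ?\<phi> (gn n x) + 1 \<partial>M)"
      using int nn[OF gn(1)] by (intro nn_integral_eq_integral) auto
    also have "(\<integral>x. ?\<phi> (gn n x) + 1 \<partial>M) = (\<integral>x. ?\<phi> (gn n x) \<partial>M) + 1"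
      using int by (simp add: prob_space)
    finally show "(\<integral>\<^sup>+ x. ennreal (?\<phi> (gn n x) + 1) \<partial>M) \<le> ennreal (C n + 1)"
      using le[of n] by (simp add: ennreal_leI)
  qed
  also have "\<dots> = ennreal (C' + 1)"
    using C by (intro lim_imp_Liminf tendsto_ennrealI tendsto_add tendsto_const) simp
  finally have fatou: "(\<integral>\<^sup>+ x. ennreal (?\<phi> (g x) + 1) \<partial>M) \<le> ennreal (C' + 1)" .
  have int1: "integrable M (\<lambda>x. ?\<phi> (g x) + 1)"
  proof (rule integrableI_nonneg)
    show "(\<lambda>x. ?\<phi> (g x) + 1) \<in> borel_measurable M" using g(2) by simp
    show "(\<integral>\<^sup>+ x. ennreal (?\<phi> (g x) + 1) \<partial>M) < \<infinity>" using fatou by (simp add: le_less_trans)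
  qed (use nn[OF g(1)] in auto)
  then show int\<phi>: "integrable M (\<lambda>x. ?\<phi> (g x))"
    using Bochner_Integration.integrable_diff[OF int1, of "\<lambda>_. 1"] by simp
  \<comment> \<open>Without this bound on \<open>C'\<close>, the truncation in \<open>ennreal (C' + 1)\<close> would lose information.\<close>
  have "- 1 \<le> C n" for n
  proof -
    have "(\<integral>x. - 1 \<partial>M) \<le> (\<integral>x. ?\<phi> (gn n x) \<partial>M)"
      using int x_ln_x_ge[OF gn(1)] by (intro integral_mono) auto
    then show ?thesis using le[of n] by (simp add: prob_space)
  qed
  then have C': "- 1 \<le> C'" using C by (intro LIMSEQ_le_const[OF C]) auto
  have "ennreal (\<integral>x. ?\<phi> (g x) + 1 \<partial>M) \<le> ennreal (C' + 1)"
    using fatou nn_integral_eq_integral[OF int1] nn[OF g(1)] by simp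
  then have "(\<integral>x. ?\<phi> (g x) + 1 \<partial>M) \<le> C' + 1" using C' by simp
  then show "(\<integral>x. ?\<phi> (g x) \<partial>M) \<le> C'" using int\<phi> by (simp add: prob_space)
qed

theorem theorem3:
  fixes \<mu> :: "real measure" and p :: "real \<Rightarrow> real" and f :: "real \<Rightarrow> real"
  assumes "prob_space \<mu>"
    and "p \<in> borel_measurable borel"
    and "\<And>x. p x > 0"
    and "\<mu> = density lborel (\<lambda>x. ennreal (p x))"
    and "absolutely_continuous_real f"
    and "integrable \<mu> (\<lambda>x. (f x)\<^sup>2)"
  shows "Ent \<mu> (\<lambda>x. (f x)\<^sup>2)
         \<le> enn2ereal (\<integral>\<^sup>+ x. ennreal (K_weight \<mu> p x * (deriv f x)\<^sup>2) \<partial>\<mu>)"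
proof (cases "\<integral>\<^sup>+ x. ennreal (K_weight \<mu> p x * (deriv f x)\<^sup>2) \<partial>\<mu>")
  case top
  then show ?thesis by (simp add: top_ereal_def)
next
  case (real B)
  interpret prob_space \<mu> by fact
  have P: "positive_density p"
    using assms(1-4) by (auto simp: positive_density_def)
  let ?k = "\<lambda>n x. truncation n (f x)"
  define Z where "Z = (\<integral>x. (f x)\<^sup>2 \<partial>\<mu>)"
  define Zn where "Zn n = (\<integral>x. (?k n x)\<^sup>2 \<partial>\<mu>)" for n
  have "?k n \<in> borel_measurable borel" for n
    by (rule borel_measurable_continuous_onI[OF absolutely_continuous_real_continuous[OF
        absolutely_continuous_real_contraction[OF assms(5) truncation_contraction]]])
  then have km: "(\<lambda>x. (?k n x)\<^sup>2) \<in> borel_measurable \<mu>" for n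
    unfolding assms(4) by simp
  have conv: "(\<lambda>n. (?k n x)\<^sup>2) \<longlonglongrightarrow> (f x)\<^sup>2" for x
    using tendsto_power[OF truncation_tendsto[of "f x"], of 2] by simp
  have "Zn \<longlonglongrightarrow> Z"
    unfolding Zn_def Z_def
  proof (rule integral_dominated_convergence[where w="\<lambda>x. (f x)\<^sup>2 + 1"])
    show "integrable \<mu> (\<lambda>x. (f x)\<^sup>2 + 1)" using assms(6) by simp
    show "AE x in \<mu>. norm ((?k n x)\<^sup>2) \<le> (f x)\<^sup>2 + 1" for n
      using truncation_square_le by simp
  qed (use assms(6) km conv in auto)
  then have "(\<lambda>n. Zn n * ln (Zn n)) \<longlonglongrightarrow> Z * ln Z"
    by (rule tendsto_x_ln_x) (simp add: Zn_def)
  then have C: "(\<lambda>n. B + Zn n * ln (Zn n)) \<longlonglongrightarrow> B + Z * ln Z"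
    by (intro tendsto_add tendsto_const)
  have B: "(\<integral>\<^sup>+ x. ennreal (K_weight \<mu> p x * (deriv f x)\<^sup>2) \<partial>\<mu>) \<le> ennreal B"
    using real by simp
  note T = log_sobolev_truncated[OF P assms(5), folded assms(4), OF B real(1)]
  note lim = integral_x_ln_x_le_liminf[where g="\<lambda>x. (f x)\<^sup>2" and gn="\<lambda>n x. (?k n x)\<^sup>2",
      OF assms(1) zero_le_power2 borel_measurable_integrable[OF assms(6)] zero_le_power2 km conv T(1)
        T(2)[folded Zn_def] C]
  have "Ent \<mu> (\<lambda>x. (f x)\<^sup>2) = ereal (\<integral>x. (f x)\<^sup>2 * ln ((f x)\<^sup>2) \<partial>\<mu>) - ereal (Z * ln Z)"
    unfolding Ent_def Z_def[symmetric] by (simp only: ext_integral_eq_integral[OF lim(1)])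
  also have "\<dots> \<le> ereal B" using lim(2) by simp
  finally show ?thesis unfolding real(2) using real(1) by (simp add: enn2ereal_ennreal)
qed

end
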